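(* Let $\{X_n;\ n\geq 1\}$ be a sequence of identically distributed negatively associated random variables, let $X$ be a random variable having the same distribution as the $X_n$, and set $S_n=\sum_{i=1}^{n}X_i$, $n\geq 1$. Let $r>1$, $q>0$, and let $$f(x)=\sum_{n\geq 3} n^{r-2}P\left(\max_{1\leq k\leq n}|S_k|>x\sqrt{n\log n}\right),\quad x>0.$$ Then the following are equivalent: (i) $\displaystyle\sum_{n\geq 3} n^{r-2-\frac{1}{2q}}(\log n)^{-\frac{1}{2q}}\,E\left(\max_{1\leq k\leq n}|S_k|^{\frac1q}-\epsilon (n\log n)^{\frac{1}{2q}}\right)^+<\infty$ for some $\epsilon>0$; (ii) $\displaystyle\int_\epsilon^\infty f(x^q)\,dx<\infty$ for some $\epsilon>0$; (iii) the following moment conditions hold: $$\begin{cases}E|X|^{\frac1q}<\infty & \text{if } q\leq\frac{1}{2r},\\ E\left[|X|^{2r}(\log^+|X|)^{-r}\right]<\infty & \text{if } q>\frac{1}{2r},\end{cases}$$ and (in all cases) $EX=0$.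
   Context: All random variables are real-valued and defined on a common probability space. A finite family of random variables $\{X_i;\ 1\leq i\leq n\}$ is said to be negatively associated (NA) if for every pair of disjoint subsets $A$ and $B$ of $\{1,2,\dots,n\}$, $$\mathrm{Cov}\left(f_1(X_i,\ i\in A),\,f_2(X_j,\ j\in B)\right)\leq 0$$ whenever $f_1$ and $f_2$ are coordinatewise increasing and the covariance exists. An infinite family of random variables is NA if every finite subfamily is NA. Notation: $y^+=\max\{y,0\}$; $\log$ is the natural logarithm and $\log^+ y=\log(\max\{e,y\})$ for $y\geq 0$. Sums, integrals and expectations of nonnegative quantities take values in $[0,\infty]$; in particular $f$ takes values in $[0,\infty]$. The condition $EX=0$ means that $X$ is integrable with mean zero. *)

theory Defs
  imports "HOL-Probability.Probability"
begin

definition covariance :: "'a measure \<Rightarrow> ('a \<Rightarrow> real) \<Rightarrow> ('a \<Rightarrow> real) \<Rightarrow> real" where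
  "covariance M U V =
     (\<integral>\<omega>. (U \<omega> - (\<integral>\<xi>. U \<xi> \<partial>M)) * (V \<omega> - (\<integral>\<xi>. V \<xi> \<partial>M)) \<partial>M)"

definition covariance_exists :: "'a measure \<Rightarrow> ('a \<Rightarrow> real) \<Rightarrow> ('a \<Rightarrow> real) \<Rightarrow> bool" where
  "covariance_exists M U V \<longleftrightarrow>
     integrable M U \<and> integrable M V \<and> integrable M (\<lambda>\<omega>. U \<omega> * V \<omega>)"

text \<open>A point of the product space indexed by \<open>A\<close> is an extensional function in
  \<open>A \<rightarrow>\<^sub>E UNIV\<close>. On this set the pointwise order is the coordinatewise order, so
  \<open>mono_on (A \<rightarrow>\<^sub>E UNIV) f\<close> says that \<open>f\<close> is coordinatewise (weakly) increasing.\<close>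

definition neg_assoc_finite :: "'a measure \<Rightarrow> 'i set \<Rightarrow> ('i \<Rightarrow> 'a \<Rightarrow> real) \<Rightarrow> bool" where
  "neg_assoc_finite M I X \<longleftrightarrow>
     (\<forall>A B (f1 :: ('i \<Rightarrow> real) \<Rightarrow> real) (f2 :: ('i \<Rightarrow> real) \<Rightarrow> real).
        A \<subseteq> I \<longrightarrow> B \<subseteq> I \<longrightarrow> A \<inter> B = {} \<longrightarrow>
        mono_on (A \<rightarrow>\<^sub>E UNIV) f1 \<longrightarrow> mono_on (B \<rightarrow>\<^sub>E UNIV) f2 \<longrightarrow>
        covariance_exists M (\<lambda>\<omega>. f1 (\<lambda>i\<in>A. X i \<omega>)) (\<lambda>\<omega>. f2 (\<lambda>j\<in>B. X j \<omega>)) \<longrightarrow>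
        covariance M (\<lambda>\<omega>. f1 (\<lambda>i\<in>A. X i \<omega>)) (\<lambda>\<omega>. f2 (\<lambda>j\<in>B. X j \<omega>)) \<le> 0)"

definition neg_assoc :: "'a measure \<Rightarrow> 'i set \<Rightarrow> ('i \<Rightarrow> 'a \<Rightarrow> real) \<Rightarrow> bool" where
  "neg_assoc M I X \<longleftrightarrow> (\<forall>J. finite J \<longrightarrow> J \<subseteq> I \<longrightarrow> neg_assoc_finite M J X)"

definition partial_sum :: "(nat \<Rightarrow> 'a \<Rightarrow> real) \<Rightarrow> nat \<Rightarrow> 'a \<Rightarrow> real" where
  "partial_sum X n \<omega> = (\<Sum>i=1..n. X i \<omega>)"

definition log_plus :: "real \<Rightarrow> real" where
  "log_plus y = ln (max (exp 1) y)"

definition tail_series :: "'a measure \<Rightarrow> (nat \<Rightarrow> 'a \<Rightarrow> real) \<Rightarrow> real \<Rightarrow> real \<Rightarrow> ennreal" where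
  "tail_series M X r x =
     (\<Sum>\<^sub>\<infinity>n\<in>{3..}. ennreal (real n powr (r - 2) *
        measure M {\<omega> \<in> space M.
          (MAX k\<in>{1..n}. \<bar>partial_sum X k \<omega>\<bar>) > x * sqrt (real n * ln (real n))}))"

end

theory Submission
  imports Defs
begin

text \<open>
  Write \<open>p = 1/q\<close>, \<open>w\<^sub>n = sqrt (n ln n)\<close> and \<open>S\<^sup>*\<^sub>n = max\<^bsub>k\<le>n\<^esub> \<bar>S\<^sub>k\<bar>\<close>.

  \<^item> (i) and (ii) say the same thing, with the same \<open>\<epsilon>\<close>: by the layer-cake formula the excess
    moment \<open>E ((S\<^sup>*\<^sub>n / w\<^sub>n)\<^sup>p - \<epsilon>)\<^sup>+\<close> is the integral over \<open>x \<ge> \<epsilon>\<close> of \<open>P (S\<^sup>*\<^sub>n > x\<^sup>q w\<^sub>n)\<close>, and sum and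
    integral of nonnegative functions commute
    (\<open>sum_excess_moments_eq_integral_tail_series\<close>).

  \<^item> (iii) implies (ii).  Either \<open>S\<^sup>*\<^sub>n > z w\<^sub>n\<close> is caused by one summand larger than a small
    multiple \<open>\<delta> z w\<^sub>n\<close> of the threshold, or some partial sum of the summands clipped at this level
    is too large.  Clipping is monotone, so negative association bounds the moment generating
    function of the clipped sum by the product of the marginal ones, and a Chernoff bound applies.
    Under (iii) the variable \<open>X\<close> has mean zero and a finite moment of the order \<open>1 + r > 2\<close>; with
    an exponential parameter proportional to \<open>ln (n z) / (z w\<^sub>n)\<close> the clipped part has
    probability at most \<open>C (n z)\<^bsup>1-K\<^esup>\<close> for any prescribed \<open>K\<close>, provided that \<open>z\<close> exceeds a constant
    (\<open>exponent_choice\<close>, \<open>max_partial_sum_polynomial_tail\<close>).  Such a bound is so small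
    that the maximum over \<open>k\<close> can be treated by a union bound.  What remains is the sum over
    \<open>n\<close> of \<open>n\<^bsup>r-1\<^esup> P (\<bar>X\<bar> > \<delta> z w\<^sub>n)\<close>, integrated over \<open>z = x\<^sup>q\<close>.  For \<open>p \<ge> 2 r\<close> the integral gives \<open>w\<^sub>n\<^bsup>-p\<^esup> E \<bar>X\<bar>\<^sup>p\<close> up to a constant, and
    \<open>n\<^bsup>r-1\<^esup> w\<^sub>n\<^bsup>-p\<^esup>\<close> is summable.  For \<open>p < 2 r\<close> the sum gives the logarithmic moment, because
    \<open>w\<^sub>n < v\<close> holds for about \<open>v\<^sup>2 / log\<^sup>+ v\<close> indices.

  \<^item> (ii) implies (iii).  As \<open>f\<close> decreases, (ii) gives \<open>f z\<^sub>0 < \<infinity>\<close> for some \<open>z\<^sub>0\<close>, and a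
    comparison over the dyadic blocks \<open>m \<le> n \<le> 2 m\<close> shows that \<open>P (S\<^sup>*\<^sub>m > 2 z\<^sub>0 w\<^sub>m)\<close> tends to
    \<open>0\<close>; here \<open>r > 1\<close> enters.  The indicators of \<open>X\<^sub>k > t\<close> are pairwise negatively correlated, so
    the second moment method yields \<open>n P (\<bar>X\<bar> > 2 t) \<le> 4 P (S\<^sup>*\<^sub>n > t)\<close> as soon as the right-hand
    probability is at most \<open>1/2\<close> (\<open>abs_tail_le_max_partial_sum\<close>).  Counting indices
    again, now from below, turns this into the logarithmic moment (\<open>log_moment_finite\<close>).
    The moment of order \<open>p\<close> is already contained in the single term \<open>n = 3\<close>, and a nonzero mean
    would, by Chebyshev, contradict \<open>P (S\<^sup>*\<^sub>m > 2 z\<^sub>0 w\<^sub>m) \<rightarrow> 0\<close>.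
\<close>

section \<open>Elementary estimates\<close>

definition norming :: "nat \<Rightarrow> real" where
  "norming n = sqrt (real n * ln (real n))"

text \<open>For \<open>u \<le> 1\<close> the quadratic Taylor bound suffices; for larger \<open>u\<close> the last summand alone
  exceeds \<open>exp u\<close>.  After integration, the large values of a variable that is bounded above by \<open>a\<close> thus
  cost \<open>exp a\<close> times a moment of order \<open>s\<close>.\<close>

lemma exp_le_quadratic_plus_power:
  fixes u a s :: real
  assumes "u \<le> a" and "0 \<le> s"
  shows "exp u \<le> 1 + u + u\<^sup>2 + exp a * \<bar>u\<bar> powr s"
proof -
  consider "u \<le> 0" | "0 \<le> u" "u \<le> 1" | "1 < u" by linarith
  then show ?thesis
  proof cases
    case 1
    define v where "v = - u"
    have v: "0 \<le> v" using 1 by (simp add: v_def)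
    have "1 \<le> (1 - v + v\<^sup>2) * (1 + v + v\<^sup>2 / 2)"
    proof -
      have "(1 - v + v\<^sup>2) * (1 + v + v\<^sup>2 / 2) = 1 + v^2/2 + v^3/2 + v^4/2"
        by (simp add: field_simps power2_eq_square power3_eq_cube power4_eq_xxxx)
      then show ?thesis using v by simp
    qed
    also have "\<dots> \<le> (1 - v + v\<^sup>2) * exp v"
    proof (rule mult_left_mono)
      have "0 \<le> (v - 1/2)^2" by simp
      then show "0 \<le> 1 - v + v\<^sup>2" by (simp add: power2_eq_square algebra_simps)
    qed (use exp_lower_Taylor_quadratic[OF v] in simp)
    finally have "1 \<le> (1 - v + v\<^sup>2) * exp v" .
    then have "exp (- v) \<le> 1 - v + v\<^sup>2"
      by (simp add: exp_minus field_simps)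
    then have "exp u \<le> 1 + u + u\<^sup>2" by (simp add: v_def)
    then show ?thesis by (smt (verit) exp_gt_zero mult_nonneg_nonneg powr_ge_zero)
  next
    case 2
    then have "exp u \<le> 1 + u + u\<^sup>2" by (rule exp_bound)
    then show ?thesis by (smt (verit) exp_gt_zero mult_nonneg_nonneg powr_ge_zero)
  next
    case 3
    have "exp u \<le> exp a * 1" using assms by simp
    also have "\<dots> \<le> exp a * \<bar>u\<bar> powr s"
      using 3 assms by (intro mult_left_mono ge_one_powr_ge_zero) auto
    finally show ?thesis using 3 by (smt (verit) zero_le_power2)
  qed
qed

lemma max_exp_pos: "0 < max (exp 1) (x :: real)"
  by (rule less_le_trans[of _ "exp 1"]) auto

lemma log_plus_ge_1: "1 \<le> log_plus x"
  unfolding log_plus_def using max_exp_pos[of x] by (subst ln_ge_iff) auto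

lemma log_plus_pos: "0 < log_plus x"
  using log_plus_ge_1[of x] by linarith

lemma log_plus_mono: "x \<le> y \<Longrightarrow> log_plus x \<le> log_plus y"
  unfolding log_plus_def using max_exp_pos[of x] max_exp_pos[of y] by (subst ln_le_cancel_iff) auto

lemma ln_le_log_plus: "0 < x \<Longrightarrow> ln x \<le> log_plus x"
  unfolding log_plus_def using max_exp_pos[of x] by (subst ln_le_cancel_iff) auto

lemma log_plus_eq: "log_plus x = (if x \<le> exp 1 then 1 else ln x)"
  by (auto simp: log_plus_def max_def)

text \<open>Since both factors are at least \<open>1\<close>, their sum is at most twice their product.  The product
  form separates the variable from the scale when \<open>\<bar>X\<bar>\<close> is rescaled.\<close>

lemma log_plus_mult_le:
  assumes "0 < a" "0 < b"
  shows "log_plus (a * b) \<le> 2 * log_plus a * log_plus b"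
proof -
  have 1: "log_plus a + log_plus b \<le> 2 * log_plus a * log_plus b"
  proof -
    have "0 \<le> (log_plus a - 1) * log_plus b" "0 \<le> (log_plus b - 1) * log_plus a"
      using log_plus_ge_1[of a] log_plus_ge_1[of b] by (intro mult_nonneg_nonneg; linarith)+
    then show ?thesis by (simp add: algebra_simps)
  qed
  have "log_plus (a * b) \<le> log_plus a + log_plus b"
    using ln_le_log_plus[OF assms(1)] ln_le_log_plus[OF assms(2)] assms
      log_plus_ge_1[of a] log_plus_ge_1[of b]
    by (simp add: log_plus_eq[of "a * b"] ln_mult)
  with 1 show ?thesis by linarith
qed

lemma log_plus_le_powr:
  assumes "1 \<le> x" "0 < a"
  shows "log_plus x \<le> (1 + 1 / a) * x powr a"
proof -
  have "1 \<le> x powr a" using assms by (simp add: ge_one_powr_ge_zero)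
  moreover have "ln x \<le> x powr a / a" using assms by (rule ln_powr_bound)
  moreover have "0 \<le> x powr a / a" using assms by simp
  moreover have "(1 + 1 / a) * x powr a = x powr a + x powr a / a" by (simp add: algebra_simps)
  ultimately show ?thesis by (cases "x \<le> exp 1") (auto simp: log_plus_eq)
qed

lemma log_plus_le_self: "1 \<le> x \<Longrightarrow> log_plus x \<le> x"
  using ln_le_minus_one[of x] by (auto simp: log_plus_eq)

lemma log_plus_measurable [measurable]: "log_plus \<in> borel_measurable borel"
  unfolding log_plus_def by measurable

lemma norming_pos: "2 \<le> n \<Longrightarrow> 0 < norming n"
  by (simp add: norming_def)

lemma norming_nonneg: "0 \<le> norming n"
  by (cases "n = 0") (simp_all add: norming_def)

lemma norming_sq: "(norming n)\<^sup>2 = real n * ln (real n)"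
  by (cases "n = 0") (simp_all add: norming_def)

lemma ln_ge_1: "3 \<le> n \<Longrightarrow> 1 \<le> ln (real n)"
  using exp_le by (subst ln_ge_iff) (auto intro: order_trans)

lemma norming_mono: "1 \<le> m \<Longrightarrow> m \<le> n \<Longrightarrow> norming m \<le> norming n"
  unfolding norming_def by (intro real_sqrt_le_mono mult_mono) auto

lemma norming_doubled:
  assumes "2 \<le> m"
  shows "norming (2 * m) \<le> 2 * norming m"
proof -
  have "ln (real (2 * m)) \<le> 2 * ln (real m)"
    using assms by (simp add: ln_mult)
  then have "real (2 * m) * ln (real (2 * m)) \<le> real (2 * m) * (2 * ln (real m))"
    by (intro mult_left_mono) auto
  also have "\<dots> = 4 * (real m * ln (real m))" by simp
  finally have "norming (2 * m) \<le> sqrt (4 * (real m * ln (real m)))"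
    unfolding norming_def by (rule real_sqrt_le_mono)
  then show ?thesis by (simp add: norming_def real_sqrt_mult)
qed

lemma norming_powr: "1 \<le> n \<Longrightarrow> norming n powr a = real n powr (a / 2) * ln (real n) powr (a / 2)"
  unfolding norming_def by (simp add: powr_half_sqrt[symmetric] powr_powr powr_mult)

text \<open>Cauchy condensation reduces this to the series of \<open>k\<^bsup>-r\<^esup>\<close>.  The shift by \<open>2\<close> inside the
  logarithm makes the terms decreasing from \<open>n = 1\<close> on, as condensation requires.\<close>

lemma summable_inverse_log_power:
  assumes "1 < r"
  shows "summable (\<lambda>n. 1 / (real n * ln (real n + 2) powr r))"
proof -
  let ?f = "\<lambda>n. 1 / (real n * ln (real n + 2) powr r)"
  have "summable ?f \<longleftrightarrow> summable (\<lambda>n. 2^n * ?f (2^n))"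
  proof (rule condensation_test)
    fix m :: nat assume "0 < m"
    then show "?f (Suc m) \<le> ?f m" using assms
      by (intro divide_left_mono mult_mono powr_mono2 mult_pos_pos) auto
  qed simp
  also have "(\<lambda>n. 2^n * ?f (2^n)) = (\<lambda>n. ln (2 ^ n + 2) powr (- r))"
    by (auto simp: powr_minus field_simps)
  also have "summable \<dots>"
  proof (rule summable_comparison_test'[of _ 1])
    show "summable (\<lambda>n. ln 2 powr (- r) * real n powr (- r))"
      using assms by (intro summable_mult) (simp add: summable_real_powr_iff)
    fix n :: nat assume n: "1 \<le> n"
    have "real n * ln 2 = ln (2 ^ n)" by (simp add: ln_realpow)
    also have "\<dots> \<le> ln (2 ^ n + 2)" by (subst ln_le_cancel_iff) (auto intro: add_pos_pos)
    finally have "ln (2 ^ n + 2) powr (- r) \<le> (real n * ln 2) powr (- r)"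
      using n assms by (intro powr_mono2') auto
    then show "norm (ln (2 ^ n + 2) powr (- r)) \<le> ln 2 powr (- r) * real n powr (- r)"
      using n by (simp add: powr_mult mult.commute)
  qed
  finally show ?thesis .
qed

text \<open>The case \<open>p = 2 r\<close>, where the general term is \<open>1 / (n (ln n)\<^sup>r)\<close>, dominates all the others.\<close>

lemma summable_norming_powr:
  assumes "1 < r" "2 * r \<le> p"
  shows "summable (\<lambda>n. real n powr (r - 1) * norming n powr (- p))"
proof (rule summable_comparison_test'[of _ 3])
  have "summable (\<lambda>n. 1 / (real n * ln (real n + 2) powr r))"
    by (rule summable_inverse_log_power) fact
  then have "summable (\<lambda>n. 1 / (real (n - 2) * ln (real (n - 2) + 2) powr r))"
    by (subst summable_iff_shift[of _ 2, symmetric]) simp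
  then show "summable (\<lambda>n. 3 * (1 / (real (n - 2) * ln (real (n - 2) + 2) powr r)))"
    by (rule summable_mult)
  fix n :: nat assume n: "3 \<le> n"
  have l: "1 \<le> ln (real n)" using n by (rule ln_ge_1)
  have "real n powr (r - 1) * norming n powr (- p) = real n powr (r - 1 - p / 2) * ln (real n) powr (- p / 2)"
    using n by (simp add: norming_powr powr_add[symmetric] algebra_simps)
  also have "\<dots> \<le> real n powr (- 1) * ln (real n) powr (- r)"
    using n l assms by (intro mult_mono powr_mono) auto
  also have "\<dots> = 1 / (real n * ln (real n) powr r)"
    using n by (simp add: powr_minus field_simps)
  also have "\<dots> \<le> 3 * (1 / (real (n - 2) * ln (real (n - 2) + 2) powr r))"
  proof -
    have "real (n - 2) * ln (real n) powr r \<le> 3 * (real n * ln (real n) powr r)"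
      by (simp add: mult.assoc[symmetric] mult_right_mono)
    then show ?thesis using n l by (simp add: of_nat_diff field_simps)
  qed
  finally show "norm (real n powr (r - 1) * norming n powr (- p)) \<le> 3 * (1 / (real (n - 2) * ln (real (n - 2) + 2) powr r))"
    by simp
qed

lemma infsum_atLeast_eq_suminf:
  fixes f :: "nat \<Rightarrow> ennreal"
  shows "(\<Sum>\<^sub>\<infinity>n\<in>{m..}. f n) = (\<Sum>n. f n * indicator {m..} n)"
proof -
  have "(\<Sum>\<^sub>\<infinity>n\<in>{m..}. f n) = (\<Sum>\<^sub>\<infinity>n\<in>UNIV. f n * indicator {m..} n)"
    by (rule infsum_cong_neutral) (auto simp: indicator_def)
  also have "(\<lambda>n. f n * indicator {m..} n) sums \<dots>"
    by (intro has_sum_imp_sums has_sum_infsum nonneg_summable_on_complete) auto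
  then have "(\<Sum>\<^sub>\<infinity>n\<in>UNIV. f n * indicator {m..} n) = (\<Sum>n. f n * indicator {m..} n)"
    by (rule sums_unique)
  finally show ?thesis .
qed

section \<open>Counting the indices below a threshold\<close>

text \<open>Inverting \<open>w\<^sub>n = sqrt (n ln n)\<close>: from \<open>w\<^sub>n < v\<close> it follows that \<open>n \<le> 3 v\<^sup>2 / log\<^sup>+ v\<close>, because
  otherwise \<open>ln n \<ge> log\<^sup>+ v\<close> and then \<open>n ln n \<ge> v\<^sup>2\<close>.\<close>

lemma sum_powr_norming_le:
  fixes v :: real
  assumes "1 < r" "0 < v"
  shows "(\<Sum>n. ennreal (real n powr (r - 1)) * indicator {n. 3 \<le> n \<and> norming n < v} n)
           \<le> ennreal ((3 * (v\<^sup>2 / log_plus v)) powr r)"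
proof -
  define A where "A = 3 * (v\<^sup>2 / log_plus v)"
  have A: "0 < A" using assms by (simp add: A_def log_plus_pos)
  define J where "J = {n. 3 \<le> n \<and> norming n < v}"
  have le: "real n \<le> A" if "n \<in> J" for n
  proof (rule ccontr)
    assume "\<not> real n \<le> A"
    then have nA: "A < real n" by simp
    from that have n: "3 \<le> n" "norming n < v" by (auto simp: J_def)
    have "norming n ^ 2 < v^2" using n norming_nonneg by (intro power_strict_mono) auto
    then have lt: "real n * ln (real n) < v\<^sup>2" by (simp add: norming_sq)
    have "1 < real n * ln (real n)"
      using mult_mono[of 2 "real n" 1 "ln (real n)"] n ln_ge_1[of n] by simp
    with lt have "1 < v\<^sup>2" by linarith
    then have v: "1 < v" using assms by (simp add: power2_eq_square one_less_power less_1_mult)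
          (metis mult_le_one not_less order_less_imp_le)
    \<comment> \<open>This is where the factor \<open>3 \<ge> e\<close> is needed: it puts \<open>n\<close> above \<open>max e v\<close>.\<close>
    have "3 * v \<le> A"
      using log_plus_le_self[of v] v log_plus_pos[of v]
      unfolding A_def by (simp add: field_simps power2_eq_square)
    then have "max (exp 1) v \<le> real n" using nA v exp_le by auto
    then have l: "log_plus v \<le> ln (real n)"
      unfolding log_plus_def using v n by (subst ln_le_cancel_iff) auto
    have "v\<^sup>2 \<le> A * log_plus v" using log_plus_pos[of v] unfolding A_def by simp
    also have "\<dots> \<le> real n * ln (real n)"
      using l nA log_plus_pos[of v] by (intro mult_mono) auto
    finally show False using lt by simp
  qed
  define N where "N = nat \<lfloor>A\<rfloor>"
  have sub: "J \<subseteq> {1..N}"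
    using le by (force simp: N_def J_def le_nat_floor)
  have NA: "real N \<le> A" using A by (simp add: N_def)
  have "(\<Sum>n. ennreal (real n powr (r - 1)) * indicator J n)
      = (\<Sum>n\<in>{1..N}. ennreal (real n powr (r - 1)) * indicator J n)"
    using sub by (intro suminf_finite) (auto simp: indicator_def)
  also have "\<dots> \<le> (\<Sum>n\<in>{1..N}. ennreal (A powr (r - 1)))"
    using assms NA by (intro sum_mono) (auto simp: indicator_def intro!: ennreal_leI powr_mono2 le)
  also have "\<dots> = ennreal (real N * A powr (r - 1))"
    by (simp add: ennreal_mult ennreal_of_nat_eq_real_of_nat)
  also have "\<dots> \<le> ennreal (A * A powr (r - 1))"
    using NA by (intro ennreal_leI mult_right_mono) auto
  also have "A * A powr (r - 1) = A powr r" using A by (simp add: powr_mult_base)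
  finally show ?thesis by (simp add: A_def J_def)
qed

text \<open>The converse count.  With \<open>A\<close> a small multiple of \<open>y\<^sup>2 / log\<^sup>+ \<bar>y\<bar>\<close>, all \<open>n\<close> in \<open>[A/2, A]\<close>
  satisfy \<open>c w\<^sub>n < \<bar>y\<bar>\<close>; there are at least \<open>A/4\<close> of them, and each contributes at least
  \<open>(A/2)\<^bsup>r-1\<^esup>\<close>.  The constant \<open>C1\<close> takes care of those \<open>y\<close> for which \<open>A\<close> is too small for this block
  to lie above \<open>m\<close>.\<close>

lemma sum_powr_norming_ge:
  fixes c :: real
  assumes "1 < r" "0 < c"
  obtains C1 C2 where "0 \<le> C1" "0 \<le> C2"
    "\<And>y. ennreal ((y\<^sup>2 / log_plus \<bar>y\<bar>) powr r) \<le> ennreal C1 + ennreal C2 *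
      (\<Sum>n. ennreal (real n powr (r - 1)) * indicator {n. m \<le> n \<and> c * norming n < \<bar>y\<bar>} n)"
proof -
  define \<eta> where "\<eta> = min 1 (1 / (4 * c\<^sup>2))"
  have \<eta>: "0 < \<eta>" "\<eta> \<le> 1" "\<eta> \<le> 1 / (4 * c\<^sup>2)" using assms by (auto simp: \<eta>_def)
  define D where "D = 2 * real m + 8"
  define C1 where "C1 = (D / \<eta>) powr r"
  define C2 where "C2 = (1 / \<eta>) powr r * 2 powr (r + 1)"
  show ?thesis
  proof (rule that[of C1 C2])
    show "0 \<le> C1" "0 \<le> C2" by (auto simp: C1_def C2_def)
    fix y :: real
    define A where "A = \<eta> * (y\<^sup>2 / log_plus \<bar>y\<bar>)"
    define J where "J = {n. m \<le> n \<and> c * norming n < \<bar>y\<bar>}"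
    have yA: "y\<^sup>2 / log_plus \<bar>y\<bar> = A / \<eta>" using \<eta> by (simp add: A_def)
    have A0: "0 \<le> A" using \<eta> log_plus_pos[of "\<bar>y\<bar>"] by (simp add: A_def)
    show "ennreal ((y\<^sup>2 / log_plus \<bar>y\<bar>) powr r) \<le> ennreal C1 + ennreal C2 *
      (\<Sum>n. ennreal (real n powr (r - 1)) * indicator {n. m \<le> n \<and> c * norming n < \<bar>y\<bar>} n)"
    proof (cases "A \<le> D")
      case True
      have "(y\<^sup>2 / log_plus \<bar>y\<bar>) powr r \<le> C1"
        unfolding C1_def yA using True A0 \<eta> assms
        by (intro powr_mono2 divide_right_mono) auto
      then have "ennreal ((y\<^sup>2 / log_plus \<bar>y\<bar>) powr r) \<le> ennreal C1" by (rule ennreal_leI)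
      also have "\<dots> \<le> ennreal C1 + z" for z by simp
      finally show ?thesis .
    next
      case False
      then have AD: "2 * real m + 8 < A" by (simp add: D_def)
      have "A \<le> 1 * (y\<^sup>2 / 1)"
        unfolding A_def using \<eta> log_plus_ge_1[of "\<bar>y\<bar>"]
        by (intro mult_mono divide_left_mono) auto
      then have Ay: "A \<le> y\<^sup>2" by simp
      then have y0: "y \<noteq> 0" using AD by auto
      have "ln A \<le> ln (\<bar>y\<bar> ^ 2)" using Ay AD by (subst ln_le_cancel_iff) auto
      also have "\<dots> = 2 * ln \<bar>y\<bar>" using y0 by (subst ln_realpow) auto
      also have "\<dots> \<le> 2 * log_plus \<bar>y\<bar>" using ln_le_log_plus[of "\<bar>y\<bar>"] y0 by simp
      finally have lA: "ln A \<le> 2 * log_plus \<bar>y\<bar>" .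
      define F where "F = {nat \<lceil>A / 2\<rceil> .. nat \<lfloor>A\<rfloor>}"
      have FA: "A / 2 \<le> real n" "real n \<le> A" if "n \<in> F" for n
        using that AD unfolding F_def by (auto; linarith)+
      have FJ: "F \<subseteq> J"
      proof
        fix n assume n: "n \<in> F"
        note b = FA[OF n]
        have "real n * ln (real n) \<le> A * (2 * log_plus \<bar>y\<bar>)"
        proof (rule mult_mono)
          have "ln (real n) \<le> ln A" using b AD by (subst ln_le_cancel_iff) auto
          then show "ln (real n) \<le> 2 * log_plus \<bar>y\<bar>" using lA by simp
        qed (use b AD in auto)
        also have "\<dots> = 2 * \<eta> * y\<^sup>2" using log_plus_pos[of "\<bar>y\<bar>"] by (simp add: A_def)
        also have "\<dots> \<le> 2 * (1 / (4 * c\<^sup>2)) * y\<^sup>2"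
          using \<eta> by (intro mult_right_mono mult_left_mono) auto
        also have "\<dots> < y\<^sup>2 / c\<^sup>2" using y0 assms by (simp add: field_simps)
        finally have "c\<^sup>2 * (norming n)\<^sup>2 < y\<^sup>2"
          using assms by (simp add: norming_sq field_simps)
        then have "(c * norming n)\<^sup>2 < \<bar>y\<bar>\<^sup>2" by (simp add: power_mult_distrib)
        then have "c * norming n < \<bar>y\<bar>" by (rule power_less_imp_less_base) simp
        then show "n \<in> J" using b AD by (simp add: J_def)
      qed
      have cF: "A / 4 \<le> real (card F)"
        using AD unfolding F_def by (simp add: nat_diff_distrib Suc_diff_le) linarith
      have "(1 / \<eta>) powr r * A powr r = C2 * (A / 4 * (A / 2) powr (r - 1))"
      proof -
        have "A / 4 * (A / 2) powr (r - 1) = (1/2) * ((A / 2) * (A / 2) powr (r - 1))" by simp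
        also have "(A / 2) * (A / 2) powr (r - 1) = (A / 2) powr r"
          using A0 by (intro powr_mult_base[of "A / 2" "r - 1", THEN trans]) auto
        also have "(1/2) * (A / 2) powr r = A powr r * 2 powr (- (r + 1))"
          using A0 by (simp add: powr_divide powr_minus powr_add powr_diff field_simps)
        finally have e: "A / 4 * (A / 2) powr (r - 1) = A powr r * 2 powr (- (r + 1))" .
        have "2 powr (r + 1) * 2 powr (- (r + 1)) = (1 :: real)" by (simp flip: powr_add)
        then show ?thesis unfolding e C2_def by (simp only: mult.assoc mult.left_commute mult_1_right) (rule mult.commute)
      qed
      also have "\<dots> \<le> C2 * (real (card F) * (A / 2) powr (r - 1))"
        using cF by (intro mult_left_mono mult_right_mono) (auto simp: C2_def)
      also have "\<dots> = C2 * (\<Sum>n\<in>F. (A / 2) powr (r - 1))" by simp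
      also have "\<dots> \<le> C2 * (\<Sum>n\<in>F. real n powr (r - 1))"
        using FA A0 assms by (intro mult_left_mono sum_mono powr_mono2) (auto simp: C2_def)
      also have "(1 / \<eta>) powr r * A powr r = (y\<^sup>2 / log_plus \<bar>y\<bar>) powr r"
        using \<eta> A0 by (simp add: yA powr_divide)
      finally have "(y\<^sup>2 / log_plus \<bar>y\<bar>) powr r \<le> C2 * (\<Sum>n\<in>F. real n powr (r - 1))" .
      then have "ennreal ((y\<^sup>2 / log_plus \<bar>y\<bar>) powr r) \<le> ennreal (C2 * (\<Sum>n\<in>F. real n powr (r - 1)))"
        by (rule ennreal_leI)
      also have "\<dots> = ennreal C2 * (\<Sum>n\<in>F. ennreal (real n powr (r - 1)) * indicator J n)"
        using FJ by (subst ennreal_mult)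
          (auto simp: C2_def sum_nonneg sum_ennreal[symmetric] indicator_def subset_iff simp del: sum_ennreal intro!: arg_cong2[of _ _ _ _ "(*)"] sum.cong)
      also have "\<dots> \<le> ennreal C2 * (\<Sum>n. ennreal (real n powr (r - 1)) * indicator J n)"
        by (intro mult_left_mono sum_le_suminf) (auto simp: F_def)
      also have "\<dots> \<le> ennreal C1 + \<dots>" by simp
      finally show ?thesis by (simp add: J_def)
    qed
  qed
qed

section \<open>Integrals of tails\<close>

lemma layer_cake:
  fixes W :: "'a \<Rightarrow> real"
  assumes "sigma_finite_measure M" and [measurable]: "W \<in> borel_measurable M"
  shows "(\<integral>\<^sup>+x\<in>{\<epsilon>..}. emeasure M {\<omega>\<in>space M. x < W \<omega>} \<partial>lborel)
    = (\<integral>\<^sup>+\<omega>. ennreal (max 0 (W \<omega> - \<epsilon>)) \<partial>M)"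
proof -
  interpret M: sigma_finite_measure M by fact
  interpret pair_sigma_finite lborel M ..
  define g :: "real \<Rightarrow> 'a \<Rightarrow> ennreal" where "g x \<omega> = indicator {(x, \<omega>). \<epsilon> \<le> x \<and> x < W \<omega>} (x, \<omega>)" for x \<omega>
  have [measurable]: "case_prod g \<in> borel_measurable (lborel \<Otimes>\<^sub>M M)"
    unfolding g_def by measurable
  have "(\<integral>\<^sup>+x\<in>{\<epsilon>..}. emeasure M {\<omega>\<in>space M. x < W \<omega>} \<partial>lborel) = (\<integral>\<^sup>+x. (\<integral>\<^sup>+\<omega>. g x \<omega> \<partial>M) \<partial>lborel)"
  proof (rule nn_integral_cong)
    fix x :: real
    have "(\<integral>\<^sup>+\<omega>. g x \<omega> \<partial>M) = (\<integral>\<^sup>+\<omega>. indicator {\<epsilon>..} x * indicator {\<omega>\<in>space M. x < W \<omega>} \<omega> \<partial>M)"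
      by (rule nn_integral_cong) (auto simp: g_def indicator_def)
    also have "\<dots> = indicator {\<epsilon>..} x * emeasure M {\<omega>\<in>space M. x < W \<omega>}"
      by (subst nn_integral_cmult_indicator) auto
    finally show "emeasure M {\<omega>\<in>space M. x < W \<omega>} * indicator {\<epsilon>..} x = (\<integral>\<^sup>+\<omega>. g x \<omega> \<partial>M)"
      by (simp add: mult.commute)
  qed
  also have "\<dots> = (\<integral>\<^sup>+\<omega>. (\<integral>\<^sup>+x. g x \<omega> \<partial>lborel) \<partial>M)"
    by (rule Fubini'[symmetric]) measurable
  also have "\<dots> = (\<integral>\<^sup>+\<omega>. ennreal (max 0 (W \<omega> - \<epsilon>)) \<partial>M)"
  proof (rule nn_integral_cong)
    fix \<omega>
    have "(\<integral>\<^sup>+x. g x \<omega> \<partial>lborel) = (\<integral>\<^sup>+x. indicator {\<epsilon>..<W \<omega>} x \<partial>lborel)"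
      by (rule nn_integral_cong) (auto simp: g_def indicator_def)
    also have "\<dots> = emeasure lborel {\<epsilon>..<W \<omega>}" by simp
    also have "\<dots> = ennreal (max 0 (W \<omega> - \<epsilon>))"
      by (cases "\<epsilon> \<le> W \<omega>") auto
    finally show "(\<integral>\<^sup>+x. g x \<omega> \<partial>lborel) = ennreal (max 0 (W \<omega> - \<epsilon>))" .
  qed
  finally show ?thesis .
qed

lemma nn_integral_powr_to_inf:
  fixes a e :: real
  assumes "e < -1" "0 < a"
  shows "(\<integral>\<^sup>+x\<in>{a..}. ennreal (x powr e) \<partial>lborel) < \<infinity>"
proof -
  have "(\<integral>\<^sup>+x. ennreal (x powr e) * indicator {a..} x \<partial>lborel) = ennreal (0 - a powr (e + 1) / (e + 1))"
  proof (rule nn_integral_FTC_atLeast[where F = "\<lambda>x. x powr (e + 1) / (e + 1)"])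
    fix x assume "a \<le> x"
    then show "DERIV (\<lambda>x. x powr (e + 1) / (e + 1)) x :> x powr e"
      using assms by (auto intro!: derivative_eq_intros)
  next
    show "((\<lambda>x. x powr (e + 1) / (e + 1)) \<longlongrightarrow> 0) at_top"
      using assms by real_asymp
  qed auto
  then show ?thesis by simp
qed

section \<open>Moment inequalities for negatively associated variables\<close>

text \<open>If \<open>f\<close> is increasing then so is \<open>x \<mapsto> - f (- x)\<close>, and changing the sign of both variables
  leaves a covariance unchanged.  So every bound on an upper tail below yields the bound on
  the lower tail as well.\<close>

lemma neg_assoc_uminus:
  assumes "neg_assoc M I X"
  shows "neg_assoc M I (\<lambda>i \<omega>. - X i \<omega>)"
  unfolding neg_assoc_def neg_assoc_finite_def
proof (intro allI impI)
  fix J A B and f1 f2 :: "('b \<Rightarrow> real) \<Rightarrow> real"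
  assume J: "finite J" "J \<subseteq> I" and AB: "A \<subseteq> J" "B \<subseteq> J" "A \<inter> B = {}"
    and m: "mono_on (A \<rightarrow>\<^sub>E UNIV) f1" "mono_on (B \<rightarrow>\<^sub>E UNIV) f2"
    and ex: "covariance_exists M (\<lambda>\<omega>. f1 (\<lambda>i\<in>A. - X i \<omega>)) (\<lambda>\<omega>. f2 (\<lambda>j\<in>B. - X j \<omega>))"
  define g where "g f C = (\<lambda>x. - f (\<lambda>i\<in>C. - x i))" for f :: "('b \<Rightarrow> real) \<Rightarrow> real" and C
  have mono_g: "mono_on (C \<rightarrow>\<^sub>E UNIV) (g f C)" if "mono_on (C \<rightarrow>\<^sub>E UNIV) f" for f C
    unfolding g_def
  proof (rule mono_onI)
    fix x y :: "'b \<Rightarrow> real"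
    assume "x \<le> y"
    then have "f (\<lambda>i\<in>C. - y i) \<le> f (\<lambda>i\<in>C. - x i)"
      by (intro mono_onD[OF that]) (auto simp: le_fun_def)
    then show "- f (\<lambda>i\<in>C. - x i) \<le> - f (\<lambda>i\<in>C. - y i)" by simp
  qed
  have g_eq: "g f C (\<lambda>i\<in>C. X i \<omega>) = - f (\<lambda>i\<in>C. - X i \<omega>)" for f C \<omega>
  proof -
    have "(\<lambda>i\<in>C. - (\<lambda>i\<in>C. X i \<omega>) i) = (\<lambda>i\<in>C. - X i \<omega>)" by (simp add: restrict_def fun_eq_iff)
    then show ?thesis unfolding g_def by (rule arg_cong[where f = "\<lambda>h. - f h"])
  qed
  have "covariance M (\<lambda>\<omega>. g f1 A (\<lambda>i\<in>A. X i \<omega>)) (\<lambda>\<omega>. g f2 B (\<lambda>j\<in>B. X j \<omega>)) \<le> 0"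
  proof -
    have "neg_assoc_finite M J X" using assms J by (simp add: neg_assoc_def)
    moreover have "covariance_exists M (\<lambda>\<omega>. g f1 A (\<lambda>i\<in>A. X i \<omega>)) (\<lambda>\<omega>. g f2 B (\<lambda>j\<in>B. X j \<omega>))"
      using ex unfolding covariance_exists_def g_eq by simp
    ultimately show ?thesis
      using AB mono_g[OF m(1)] mono_g[OF m(2)] unfolding neg_assoc_finite_def by blast
  qed
  also have "covariance M (\<lambda>\<omega>. g f1 A (\<lambda>i\<in>A. X i \<omega>)) (\<lambda>\<omega>. g f2 B (\<lambda>j\<in>B. X j \<omega>))
      = covariance M (\<lambda>\<omega>. f1 (\<lambda>i\<in>A. - X i \<omega>)) (\<lambda>\<omega>. f2 (\<lambda>j\<in>B. - X j \<omega>))"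
    unfolding g_eq covariance_def
    by (intro Bochner_Integration.integral_cong refl) (simp add: algebra_simps)
  finally show "covariance M (\<lambda>\<omega>. f1 (\<lambda>i\<in>A. - X i \<omega>)) (\<lambda>\<omega>. f2 (\<lambda>j\<in>B. - X j \<omega>)) \<le> 0" .
qed

context prob_space
begin

lemma covariance_eq:
  assumes "covariance_exists M U V"
  shows "covariance M U V = expectation (\<lambda>\<omega>. U \<omega> * V \<omega>) - expectation U * expectation V"
proof -
  have i: "integrable M U" "integrable M V" "integrable M (\<lambda>\<omega>. U \<omega> * V \<omega>)"
    using assms by (auto simp: covariance_exists_def)
  define a b where "a = expectation U" and "b = expectation V"
  have "covariance M U V = expectation (\<lambda>\<omega>. U \<omega> * V \<omega> - b * U \<omega> - a * V \<omega> + a * b)"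
    unfolding covariance_def a_def b_def
    by (intro Bochner_Integration.integral_cong refl) (simp add: algebra_simps)
  also have "\<dots> = expectation (\<lambda>\<omega>. U \<omega> * V \<omega>) - b * a - a * b + a * b"
    using i by (simp add: a_def b_def prob_space)
  finally show ?thesis by (simp add: a_def b_def)
qed

lemma neg_assoc_expectation_mult_le:
  assumes "neg_assoc M I X" "finite A" "finite B" "A \<subseteq> I" "B \<subseteq> I" "A \<inter> B = {}"
    and "mono_on (A \<rightarrow>\<^sub>E UNIV) f1" "mono_on (B \<rightarrow>\<^sub>E UNIV) f2"
    and ex: "covariance_exists M (\<lambda>\<omega>. f1 (\<lambda>i\<in>A. X i \<omega>)) (\<lambda>\<omega>. f2 (\<lambda>j\<in>B. X j \<omega>))"
  shows "expectation (\<lambda>\<omega>. f1 (\<lambda>i\<in>A. X i \<omega>) * f2 (\<lambda>j\<in>B. X j \<omega>))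
    \<le> expectation (\<lambda>\<omega>. f1 (\<lambda>i\<in>A. X i \<omega>)) * expectation (\<lambda>\<omega>. f2 (\<lambda>j\<in>B. X j \<omega>))"
proof -
  have "neg_assoc_finite M (A \<union> B) X" using assms by (auto simp: neg_assoc_def)
  then have "covariance M (\<lambda>\<omega>. f1 (\<lambda>i\<in>A. X i \<omega>)) (\<lambda>\<omega>. f2 (\<lambda>j\<in>B. X j \<omega>)) \<le> 0"
    using assms unfolding neg_assoc_finite_def by blast
  then show ?thesis using covariance_eq[OF ex] by simp
qed

lemma integrable_bounded_function:
  fixes U :: "'a \<Rightarrow> real"
  assumes "U \<in> borel_measurable M" "\<And>\<omega>. \<bar>U \<omega>\<bar> \<le> C"
  shows "integrable M U"
  by (rule integrable_const_bound[of _ C]) (use assms in auto)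

lemma integrable_mult_of_squares:
  fixes U V :: "'a \<Rightarrow> real"
  assumes [measurable]: "U \<in> borel_measurable M" "V \<in> borel_measurable M"
    and "integrable M (\<lambda>\<omega>. (U \<omega>)\<^sup>2)" "integrable M (\<lambda>\<omega>. (V \<omega>)\<^sup>2)"
  shows "integrable M (\<lambda>\<omega>. U \<omega> * V \<omega>)"
proof (rule Bochner_Integration.integrable_bound)
  show "integrable M (\<lambda>\<omega>. (U \<omega>)\<^sup>2 + (V \<omega>)\<^sup>2)" using assms by simp
  have "\<bar>a * b\<bar> \<le> a\<^sup>2 + b\<^sup>2" for a b :: real
  proof -
    have "0 \<le> (\<bar>a\<bar> - \<bar>b\<bar>)\<^sup>2" by simp
    then have "2 * (\<bar>a\<bar> * \<bar>b\<bar>) \<le> a\<^sup>2 + b\<^sup>2" by (simp add: power2_eq_square algebra_simps)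
    moreover have "0 \<le> \<bar>a\<bar> * \<bar>b\<bar>" by simp
    ultimately show ?thesis unfolding abs_mult by linarith
  qed
  then show "AE \<omega> in M. norm (U \<omega> * V \<omega>) \<le> norm ((U \<omega>)\<^sup>2 + (V \<omega>)\<^sup>2)" by auto
qed measurable

lemma neg_assoc_pair_expectation_le:
  fixes X :: "'i \<Rightarrow> 'a \<Rightarrow> real" and f g :: "real \<Rightarrow> real"
  assumes "neg_assoc M I X" "i \<in> I" "j \<in> I" "i \<noteq> j" "mono f" "mono g"
    and "integrable M (\<lambda>\<omega>. f (X i \<omega>))" "integrable M (\<lambda>\<omega>. g (X j \<omega>))"
    and "integrable M (\<lambda>\<omega>. f (X i \<omega>) * g (X j \<omega>))"
  shows "expectation (\<lambda>\<omega>. f (X i \<omega>) * g (X j \<omega>))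
    \<le> expectation (\<lambda>\<omega>. f (X i \<omega>)) * expectation (\<lambda>\<omega>. g (X j \<omega>))"
  using neg_assoc_expectation_mult_le[of I X "{i}" "{j}" "\<lambda>x. f (x i)" "\<lambda>x. g (x j)"] assms
  by (auto simp: covariance_exists_def mono_on_def mono_def le_fun_def)

text \<open>Remove one factor at a time: the product of the other factors is an increasing function of
  its coordinates, because all factors are nonnegative.  The bound \<open>C\<close> ensures that the
  covariances exist.\<close>

lemma neg_assoc_expectation_prod_le:
  fixes X :: "'i \<Rightarrow> 'a \<Rightarrow> real" and g :: "'i \<Rightarrow> real \<Rightarrow> real"
  assumes na: "neg_assoc M I X" and X: "\<And>i. i \<in> I \<Longrightarrow> X i \<in> borel_measurable M"
    and mono: "\<And>i. mono (g i)" and nonneg: "\<And>i x. 0 \<le> g i x" and bdd: "\<And>i x. g i x \<le> C"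
    and "finite A" "A \<subseteq> I"
  shows "expectation (\<lambda>\<omega>. \<Prod>i\<in>A. g i (X i \<omega>)) \<le> (\<Prod>i\<in>A. expectation (\<lambda>\<omega>. g i (X i \<omega>)))"
  using \<open>finite A\<close> \<open>A \<subseteq> I\<close>
proof (induction A)
  case empty
  then show ?case by (simp add: prob_space)
next
  case (insert a A)
  have gX [measurable]: "(\<lambda>\<omega>. g i (X i \<omega>)) \<in> borel_measurable M" if "i \<in> I" for i
    by (rule measurable_compose[OF X[OF that] borel_measurable_mono[OF mono]])
  have AI: "A \<subseteq> I" "a \<in> I" "finite A" "a \<notin> A" using insert.hyps insert.prems by auto
  define U where "U = (\<lambda>\<omega>. \<Prod>i\<in>A. g i (X i \<omega>))"
  define V where "V = (\<lambda>\<omega>. g a (X a \<omega>))"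
  have UV [measurable]: "U \<in> borel_measurable M" "V \<in> borel_measurable M"
    unfolding U_def V_def using AI by (auto intro!: borel_measurable_prod gX)
  have U: "0 \<le> U \<omega>" "U \<omega> \<le> C ^ card A" for \<omega>
    unfolding U_def using nonneg bdd prod_mono[of A "\<lambda>i. g i (X i \<omega>)" "\<lambda>_. C"] by (auto intro!: prod_nonneg)
  have V: "0 \<le> V \<omega>" "V \<omega> \<le> C" for \<omega> using nonneg bdd by (auto simp: V_def)
  have ints: "integrable M U" "integrable M V" "integrable M (\<lambda>\<omega>. U \<omega> * V \<omega>)"
  proof -
    have "0 \<le> C ^ card A" using U[of undefined] by linarith
    then have "\<bar>U \<omega>\<bar> \<le> C ^ card A" "\<bar>V \<omega>\<bar> \<le> C" "\<bar>U \<omega> * V \<omega>\<bar> \<le> C ^ card A * C" for \<omega>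
      using U[of \<omega>] V[of \<omega>] by (auto simp: abs_mult intro!: mult_mono)
    then show "integrable M U" "integrable M V" "integrable M (\<lambda>\<omega>. U \<omega> * V \<omega>)"
      by (auto intro: integrable_bounded_function[of U "C ^ card A"] integrable_bounded_function[of V C] integrable_bounded_function[of _ "C ^ card A * C"])
  qed
  have "expectation (\<lambda>\<omega>. U \<omega> * V \<omega>) \<le> expectation U * expectation V"
  proof -
    have UV': "(\<Prod>i\<in>A. g i ((\<lambda>i\<in>A. X i \<omega>) i)) = U \<omega>" "g a ((\<lambda>i\<in>{a}. X i \<omega>) a) = V \<omega>" for \<omega>
      by (auto simp: U_def V_def)
    have "mono_on (A \<rightarrow>\<^sub>E UNIV) (\<lambda>x. \<Prod>i\<in>A. g i (x i))" "mono_on ({a} \<rightarrow>\<^sub>E UNIV) (\<lambda>x. g a (x a))"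
      using mono nonneg by (auto intro!: mono_onI prod_mono monoD[OF mono] simp: le_fun_def)
    then show ?thesis
      using neg_assoc_expectation_mult_le[OF na, of A "{a}" "\<lambda>x. \<Prod>i\<in>A. g i (x i)" "\<lambda>x. g a (x a)"]
        AI ints unfolding covariance_exists_def UV' by auto
  qed
  also have "\<dots> \<le> (\<Prod>i\<in>A. expectation (\<lambda>\<omega>. g i (X i \<omega>))) * expectation V"
    using insert.IH AI V by (intro mult_right_mono) (auto simp: U_def)
  finally show ?case using AI by (simp add: U_def V_def mult.commute)
qed

text \<open>Off the diagonal \<open>E (U\<^sub>i U\<^sub>j) \<le> E U\<^sub>i E U\<^sub>j\<close>, and on the diagonal adding the square of
  the mean only weakens the bound.\<close>

lemma neg_assoc_second_moment_sum_le:
  fixes X :: "'i \<Rightarrow> 'a \<Rightarrow> real" and f :: "real \<Rightarrow> real"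
  assumes na: "neg_assoc M I X" and X: "\<And>i. i \<in> I \<Longrightarrow> X i \<in> borel_measurable M"
    and mono: "mono f" and A: "finite A" "A \<subseteq> I"
    and sq: "\<And>i. i \<in> A \<Longrightarrow> integrable M (\<lambda>\<omega>. (f (X i \<omega>))\<^sup>2)"
  shows "integrable M (\<lambda>\<omega>. (\<Sum>i\<in>A. f (X i \<omega>))\<^sup>2)"
    and "expectation (\<lambda>\<omega>. (\<Sum>i\<in>A. f (X i \<omega>))\<^sup>2)
      \<le> (\<Sum>i\<in>A. expectation (\<lambda>\<omega>. (f (X i \<omega>))\<^sup>2)) + (\<Sum>i\<in>A. expectation (\<lambda>\<omega>. f (X i \<omega>)))\<^sup>2"
proof -
  have fX [measurable]: "(\<lambda>\<omega>. f (X i \<omega>)) \<in> borel_measurable M" if "i \<in> A" for i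
    using that A by (intro measurable_compose[OF X borel_measurable_mono[OF mono]]) auto
  have int: "integrable M (\<lambda>\<omega>. f (X i \<omega>))" if "i \<in> A" for i
    by (rule square_integrable_imp_integrable[OF fX[OF that] sq[OF that]])
  have int2: "integrable M (\<lambda>\<omega>. f (X i \<omega>) * f (X j \<omega>))" if "i \<in> A" "j \<in> A" for i j
    by (rule integrable_mult_of_squares[OF fX[OF that(1)] fX[OF that(2)] sq[OF that(1)] sq[OF that(2)]])
  have expand: "(\<Sum>i\<in>A. f (X i \<omega>))\<^sup>2 = (\<Sum>i\<in>A. \<Sum>j\<in>A. f (X i \<omega>) * f (X j \<omega>))" for \<omega>
    by (simp add: power2_eq_square sum_product)
  show "integrable M (\<lambda>\<omega>. (\<Sum>i\<in>A. f (X i \<omega>))\<^sup>2)"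
    unfolding expand using int2 by (intro Bochner_Integration.integrable_sum) auto
  define e where "e i = expectation (\<lambda>\<omega>. f (X i \<omega>))" for i
  have "expectation (\<lambda>\<omega>. (\<Sum>i\<in>A. f (X i \<omega>))\<^sup>2) = (\<Sum>i\<in>A. \<Sum>j\<in>A. expectation (\<lambda>\<omega>. f (X i \<omega>) * f (X j \<omega>)))"
    unfolding expand using int2 by (subst Bochner_Integration.integral_sum, auto intro!: sum.cong Bochner_Integration.integral_sum)
  also have "\<dots> \<le> (\<Sum>i\<in>A. \<Sum>j\<in>A. (if j = i then expectation (\<lambda>\<omega>. (f (X i \<omega>))\<^sup>2) else 0) + e i * e j)"
  proof (intro sum_mono)
    fix i j assume ij: "i \<in> A" "j \<in> A"
    show "expectation (\<lambda>\<omega>. f (X i \<omega>) * f (X j \<omega>)) \<le> (if j = i then expectation (\<lambda>\<omega>. (f (X i \<omega>))\<^sup>2) else 0) + e i * e j"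
    proof (cases "i = j")
      case True
      then show ?thesis by (simp add: power2_eq_square)
    next
      case False
      then show ?thesis
        using neg_assoc_pair_expectation_le[OF na _ _ False mono mono int int int2] ij A by (auto simp: e_def)
    qed
  qed
  also have "\<dots> = (\<Sum>i\<in>A. expectation (\<lambda>\<omega>. (f (X i \<omega>))\<^sup>2)) + (\<Sum>i\<in>A. e i)\<^sup>2"
    using A by (simp add: sum.distrib power2_eq_square sum_product)
  finally show "expectation (\<lambda>\<omega>. (\<Sum>i\<in>A. f (X i \<omega>))\<^sup>2)
      \<le> (\<Sum>i\<in>A. expectation (\<lambda>\<omega>. (f (X i \<omega>))\<^sup>2)) + (\<Sum>i\<in>A. expectation (\<lambda>\<omega>. f (X i \<omega>)))\<^sup>2"
    by (simp add: e_def)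
qed

end

section \<open>Clipping and maximal partial sums\<close>

definition clip :: "real \<Rightarrow> real \<Rightarrow> real" where
  "clip y x = max (- y) (min y x)"

lemma clip_measurable [measurable]: "clip y \<in> borel_measurable borel"
  unfolding clip_def by measurable

lemma mono_clip: "mono (clip y)"
  by (auto simp: mono_def clip_def)

lemma clip_eq: "\<bar>x\<bar> \<le> y \<Longrightarrow> clip y x = x"
  by (auto simp: clip_def)

lemma abs_clip_le: "0 \<le> y \<Longrightarrow> \<bar>clip y x\<bar> \<le> y"
  by (auto simp: clip_def)

lemma abs_clip_le_abs: "0 \<le> y \<Longrightarrow> \<bar>clip y x\<bar> \<le> \<bar>x\<bar>"
  by (auto simp: clip_def)

text \<open>Clipping increases \<open>x\<close> only if \<open>x < - y\<close>, and then \<open>- x \<le> x\<^sup>2 / y\<close>.  For a centred variable this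
  bounds the mean of the clipped one by the variance over \<open>y\<close>.\<close>

lemma clip_error_le:
  assumes "0 < y"
  shows "clip y x \<le> x + x\<^sup>2 / y"
proof (cases "clip y x \<le> x")
  case True
  then show ?thesis using assms by (smt (verit) divide_nonneg_pos zero_le_power2)
next
  case False
  then have x: "x < - y" "clip y x = - y" using assms by (auto simp: clip_def split: if_splits)
  then have "y * (- x) \<le> (- x) * (- x)" using assms by (intro mult_right_mono) auto
  then have "- x \<le> x\<^sup>2 / y" using assms by (simp add: field_simps power2_eq_square)
  then show ?thesis using x assms by simp
qed

definition max_partial_sum :: "(nat \<Rightarrow> 'a \<Rightarrow> real) \<Rightarrow> nat \<Rightarrow> 'a \<Rightarrow> real" where
  "max_partial_sum X n \<omega> = (MAX k\<in>{1..n}. \<bar>partial_sum X k \<omega>\<bar>)"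

lemma less_max_partial_sum_iff:
  "1 \<le> n \<Longrightarrow> t < max_partial_sum X n \<omega> \<longleftrightarrow> (\<exists>k\<in>{1..n}. t < \<bar>partial_sum X k \<omega>\<bar>)"
  unfolding max_partial_sum_def by (subst Max_gr_iff) auto

lemma abs_le_max_partial_sum:
  assumes "k \<in> {1..n}"
  shows "\<bar>X k \<omega>\<bar> \<le> 2 * max_partial_sum X n \<omega>" "\<bar>partial_sum X k \<omega>\<bar> \<le> max_partial_sum X n \<omega>"
proof -
  have le: "\<bar>partial_sum X j \<omega>\<bar> \<le> max_partial_sum X n \<omega>" if "j \<in> {1..n}" for j
    unfolding max_partial_sum_def using that by (intro Max_ge) auto
  show "\<bar>partial_sum X k \<omega>\<bar> \<le> max_partial_sum X n \<omega>" by (rule le) fact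
  have "\<bar>partial_sum X (k - 1) \<omega>\<bar> \<le> max_partial_sum X n \<omega>"
  proof (cases "k = 1")
    case True
    then show ?thesis using le[of k] assms by (auto simp: partial_sum_def)
  next
    case False
    then show ?thesis using assms by (intro le) auto
  qed
  moreover have "X k \<omega> = partial_sum X k \<omega> - partial_sum X (k - 1) \<omega>"
    using assms by (cases k) (auto simp: partial_sum_def)
  ultimately show "\<bar>X k \<omega>\<bar> \<le> 2 * max_partial_sum X n \<omega>" using le[OF assms] by linarith
qed

lemma max_partial_sum_mono: "1 \<le> m \<Longrightarrow> m \<le> n \<Longrightarrow> max_partial_sum X m \<omega> \<le> max_partial_sum X n \<omega>"
  unfolding max_partial_sum_def by (intro Max_mono) auto

section \<open>Identically distributed negatively associated sequences\<close>

locale identically_distributed_NA = prob_space M for M :: "'a measure" +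
  fixes X :: "nat \<Rightarrow> 'a \<Rightarrow> real" and Y :: "'a \<Rightarrow> real"
  assumes X_measurable [measurable]: "\<And>n. 1 \<le> n \<Longrightarrow> X n \<in> borel_measurable M"
    and Y_measurable [measurable]: "Y \<in> borel_measurable M"
    and same_distr: "\<And>n. 1 \<le> n \<Longrightarrow> distr M borel (X n) = distr M borel Y"
    and na: "neg_assoc M {1..} X"
begin

lemma expectation_X:
  fixes f :: "real \<Rightarrow> real"
  assumes [measurable]: "f \<in> borel_measurable borel" and n: "1 \<le> n"
  shows "expectation (\<lambda>\<omega>. f (X n \<omega>)) = expectation (\<lambda>\<omega>. f (Y \<omega>))"
proof -
  have "expectation (\<lambda>\<omega>. f (X n \<omega>)) = integral\<^sup>L (distr M borel (X n)) f"
    using n by (intro integral_distr[symmetric]) auto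
  also have "\<dots> = expectation (\<lambda>\<omega>. f (Y \<omega>))"
    unfolding same_distr[OF n] by (intro integral_distr) auto
  finally show ?thesis .
qed

lemma integrable_X_iff:
  fixes f :: "real \<Rightarrow> real"
  assumes [measurable]: "f \<in> borel_measurable borel" and n: "1 \<le> n"
  shows "integrable M (\<lambda>\<omega>. f (X n \<omega>)) \<longleftrightarrow> integrable M (\<lambda>\<omega>. f (Y \<omega>))"
proof -
  have "integrable M (\<lambda>\<omega>. f (X n \<omega>)) \<longleftrightarrow> integrable (distr M borel (X n)) f"
    using n by (intro integrable_distr_eq[symmetric]) auto
  also have "\<dots> \<longleftrightarrow> integrable M (\<lambda>\<omega>. f (Y \<omega>))"
    unfolding same_distr[OF n] by (intro integrable_distr_eq) auto
  finally show ?thesis .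
qed

lemma prob_X:
  assumes [measurable]: "B \<in> sets borel" and n: "1 \<le> n"
  shows "prob {\<omega>\<in>space M. X n \<omega> \<in> B} = prob {\<omega>\<in>space M. Y \<omega> \<in> B}"
proof -
  have "prob {\<omega>\<in>space M. X n \<omega> \<in> B} = measure (distr M borel (X n)) B"
    using n by (subst measure_distr) (auto simp: vimage_def Int_def conj_commute)
  also have "\<dots> = prob {\<omega>\<in>space M. Y \<omega> \<in> B}"
    unfolding same_distr[OF n] by (subst measure_distr) (auto simp: vimage_def Int_def conj_commute)
  finally show ?thesis .
qed

lemma uminus: "identically_distributed_NA M (\<lambda>n \<omega>. - X n \<omega>) (\<lambda>\<omega>. - Y \<omega>)"
proof unfold_locales
  fix n :: nat assume n: "1 \<le> n"
  then show "(\<lambda>\<omega>. - X n \<omega>) \<in> borel_measurable M" by measurable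
  have "distr M borel (\<lambda>\<omega>. - Z \<omega>) = distr (distr M borel Z) borel uminus" if "Z \<in> borel_measurable M" for Z :: "'a \<Rightarrow> real"
    using that by (subst distr_distr) (auto simp: comp_def)
  then show "distr M borel (\<lambda>\<omega>. - X n \<omega>) = distr M borel (\<lambda>\<omega>. - Y \<omega>)"
    using n by (simp add: same_distr)
next
  show "neg_assoc M {1..} (\<lambda>n \<omega>. - X n \<omega>)" by (rule neg_assoc_uminus[OF na])
qed measurable

lemma partial_sum_measurable [measurable]: "partial_sum X n \<in> borel_measurable M"
  unfolding partial_sum_def[abs_def] by (rule borel_measurable_sum) auto

lemma max_partial_sum_measurable [measurable]: "1 \<le> n \<Longrightarrow> max_partial_sum X n \<in> borel_measurable M"
  unfolding max_partial_sum_def[abs_def] by (intro borel_measurable_Max) auto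

text \<open>The second moment method.  Let \<open>N\<close> count the exceedances.  For every \<open>a\<close> the random variable
  \<open>2 a N - a\<^sup>2 N\<^sup>2 = 1 - (1 - a N)\<^sup>2\<close> is at most the indicator of \<open>N \<ge> 1\<close>, and negative association
  gives \<open>E N\<^sup>2 \<le> E N + (E N)\<^sup>2\<close>.  The optimal \<open>a = 1 / (1 + E N)\<close> leads to
  \<open>P (N \<ge> 1) \<ge> E N / (1 + E N)\<close>; when the left-hand side is at most \<open>1/2\<close>, this forces \<open>E N \<le> 1\<close>.\<close>

lemma tail_sum_le_twice_prob_exceedance:
  assumes half: "prob {\<omega>\<in>space M. \<exists>k\<in>{1..m}. t < X k \<omega>} \<le> 1 / 2"
  shows "real m * prob {\<omega>\<in>space M. t < Y \<omega>} \<le> 2 * prob {\<omega>\<in>space M. \<exists>k\<in>{1..m}. t < X k \<omega>}"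
proof -
  define f :: "real \<Rightarrow> real" where "f = indicator {t<..}"
  define N where "N \<omega> = (\<Sum>k\<in>{1..m}. f (X k \<omega>))" for \<omega>
  define D where "D = {\<omega>\<in>space M. \<exists>k\<in>{1..m}. t < X k \<omega>}"
  have [measurable]: "f \<in> borel_measurable borel" unfolding f_def by measurable
  have mono: "mono f" by (auto simp: mono_def f_def indicator_def)
  have "D = (\<Union>k\<in>{1..m}. {\<omega>\<in>space M. t < X k \<omega>})" by (auto simp: D_def)
  also have "\<dots> \<in> events" by (intro sets.finite_UN) auto
  finally have D [measurable]: "D \<in> events" .
  have f2: "(f x)\<^sup>2 = f x" for x by (auto simp: f_def indicator_def)
  define p where "p = prob {\<omega>\<in>space M. t < Y \<omega>}"
  define E where "E = real m * p"
  have E0: "0 \<le> E" by (simp add: E_def p_def)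
  have intf: "integrable M (\<lambda>\<omega>. f (X k \<omega>))" if "k \<in> {1..m}" for k
    using that by (intro integrable_bounded_function[of _ 1]) (auto simp: f_def indicator_def)
  have "expectation (\<lambda>\<omega>. f (Y \<omega>)) = expectation (indicator {\<omega>\<in>space M. t < Y \<omega>})"
    by (intro Bochner_Integration.integral_cong) (auto simp: f_def indicator_def)
  then have fY: "expectation (\<lambda>\<omega>. f (Y \<omega>)) = p" by (simp add: p_def)
  have fX: "expectation (\<lambda>\<omega>. f (X k \<omega>)) = p" if "k \<in> {1..m}" for k
    using that fY by (subst expectation_X) auto
  have N_int: "integrable M N" unfolding N_def[abs_def] by (intro Bochner_Integration.integrable_sum intf)
  have EN: "expectation N = E"
    unfolding N_def[abs_def] using intf fX by (subst Bochner_Integration.integral_sum) (auto simp: E_def)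
  have N2_int: "integrable M (\<lambda>\<omega>. (N \<omega>)\<^sup>2)" and N2: "expectation (\<lambda>\<omega>. (N \<omega>)\<^sup>2) \<le> E + E\<^sup>2"
    using neg_assoc_second_moment_sum_le[OF na X_measurable mono, of "{1..m}"] intf fX
    unfolding f2 N_def by (auto simp: E_def)
  define a where "a = 1 / (1 + E)"
  have "expectation (\<lambda>\<omega>. 2 * a * N \<omega> - a\<^sup>2 * (N \<omega>)\<^sup>2) \<le> expectation (indicator D)"
  proof (rule integral_mono)
    show "integrable M (indicator D :: 'a \<Rightarrow> real)" by (intro integrable_bounded_function[of _ 1]) auto
    fix \<omega> assume \<omega>: "\<omega> \<in> space M"
    show "2 * a * N \<omega> - a\<^sup>2 * (N \<omega>)\<^sup>2 \<le> indicator D \<omega>"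
    proof (cases "\<omega> \<in> D")
      case True
      have "0 \<le> (1 - a * N \<omega>)\<^sup>2" by simp
      then show ?thesis using True by (simp add: power2_eq_square algebra_simps)
    next
      case False
      then have "N \<omega> = 0" using \<omega> unfolding N_def D_def f_def by (intro sum.neutral) auto
      then show ?thesis by simp
    qed
  qed (use N_int N2_int in auto)
  then have "2 * a * E - a\<^sup>2 * expectation (\<lambda>\<omega>. (N \<omega>)\<^sup>2) \<le> prob D"
    using N_int N2_int by (simp add: EN)
  moreover have "a\<^sup>2 * expectation (\<lambda>\<omega>. (N \<omega>)\<^sup>2) \<le> a\<^sup>2 * (E + E\<^sup>2)" using N2 by (intro mult_left_mono) auto
  moreover have "a\<^sup>2 * (E + E\<^sup>2) = a * E"
  proof -
    have "a\<^sup>2 * (E + E\<^sup>2) = (a * (1 + E)) * (a * E)" by (simp add: power2_eq_square algebra_simps)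
    also have "a * (1 + E) = 1" using E0 by (simp add: a_def)
    finally show ?thesis by simp
  qed
  ultimately have "a * E \<le> prob D" by linarith
  then have EP: "E \<le> prob D * (1 + E)" using E0 by (simp add: a_def field_simps)
  also have "\<dots> \<le> 1 / 2 * (1 + E)" using half E0 by (intro mult_right_mono) (auto simp: D_def)
  finally have "E \<le> 1" by simp
  then have "prob D * (1 + E) \<le> prob D * 2" by (intro mult_left_mono) auto
  with EP show ?thesis by (simp add: E_def p_def D_def)
qed

text \<open>Each \<open>X\<^sub>k\<close> is the difference of two partial sums, so \<open>\<bar>X\<^sub>k\<bar> \<le> 2 S\<^sup>*\<^sub>m\<close>.  The factor \<open>4\<close> combines the
  second moment method for both signs.\<close>

lemma abs_tail_le_max_partial_sum:
  assumes m: "1 \<le> m" and half: "prob {\<omega>\<in>space M. t < max_partial_sum X m \<omega>} \<le> 1 / 2"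
  shows "real m * prob {\<omega>\<in>space M. 2 * t < \<bar>Y \<omega>\<bar>} \<le> 4 * prob {\<omega>\<in>space M. t < max_partial_sum X m \<omega>}"
proof -
  let ?b = "prob {\<omega>\<in>space M. t < max_partial_sum X m \<omega>}"
  interpret neg: identically_distributed_NA M "\<lambda>n \<omega>. - X n \<omega>" "\<lambda>\<omega>. - Y \<omega>" by (rule uminus)
  have le: "prob {\<omega>\<in>space M. \<exists>k\<in>{1..m}. 2 * t < X k \<omega>} \<le> ?b"
    "prob {\<omega>\<in>space M. \<exists>k\<in>{1..m}. 2 * t < - X k \<omega>} \<le> ?b"
    using abs_le_max_partial_sum(1)[of _ m X] m
    by (auto intro!: finite_measure_mono) (smt (verit) abs_le_max_partial_sum(1) atLeastAtMost_iff)+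
  have "prob {\<omega>\<in>space M. 2 * t < \<bar>Y \<omega>\<bar>} \<le> prob ({\<omega>\<in>space M. 2 * t < Y \<omega>} \<union> {\<omega>\<in>space M. 2 * t < - Y \<omega>})"
    by (intro finite_measure_mono) auto
  also have "\<dots> \<le> prob {\<omega>\<in>space M. 2 * t < Y \<omega>} + prob {\<omega>\<in>space M. 2 * t < - Y \<omega>}"
    by (intro measure_Un_le) auto
  finally have "real m * prob {\<omega>\<in>space M. 2 * t < \<bar>Y \<omega>\<bar>}
      \<le> real m * (prob {\<omega>\<in>space M. 2 * t < Y \<omega>} + prob {\<omega>\<in>space M. 2 * t < - Y \<omega>})"
    by (intro mult_left_mono) auto
  then show ?thesis
    using tail_sum_le_twice_prob_exceedance[of m "2 * t"] neg.tail_sum_le_twice_prob_exceedance[of m "2 * t"] le half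
    by (simp add: distrib_left)
qed

text \<open>The three terms of the exponent come from the mean that clipping creates, from the variance,
  and from the values above \<open>1 / \<theta>\<close>, which are controlled by the moment of order \<open>s\<close>.\<close>

lemma clipped_mgf_le:
  assumes "integrable M Y" "expectation Y = 0" "integrable M (\<lambda>\<omega>. (Y \<omega>)\<^sup>2)"
    and "integrable M (\<lambda>\<omega>. \<bar>Y \<omega>\<bar> powr s)" "0 \<le> s" "0 < \<theta>" "0 < y"
  defines "V \<equiv> expectation (\<lambda>\<omega>. (Y \<omega>)\<^sup>2)" and "B \<equiv> expectation (\<lambda>\<omega>. \<bar>Y \<omega>\<bar> powr s)"
  shows "expectation (\<lambda>\<omega>. exp (\<theta> * clip y (Y \<omega>)))
    \<le> exp (\<theta> * V / y + \<theta>\<^sup>2 * V + exp (\<theta> * y) * \<theta> powr s * B)"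
proof -
  \<comment> \<open>The integrand is bounded by an expression in the unclipped variable, whose mean is zero.\<close>
  have pt: "exp (\<theta> * clip y x) \<le> 1 + \<theta> * (x + x\<^sup>2 / y) + \<theta>\<^sup>2 * x\<^sup>2 + exp (\<theta> * y) * \<theta> powr s * \<bar>x\<bar> powr s" for x
  proof -
    define u where "u = \<theta> * clip y x"
    have "\<bar>clip y x\<bar> \<le> y" "\<bar>clip y x\<bar> \<le> \<bar>x\<bar>" using assms abs_clip_le abs_clip_le_abs by auto
    then have u: "\<bar>u\<bar> \<le> \<theta> * y" "\<bar>u\<bar> \<le> \<theta> * \<bar>x\<bar>" using assms by (auto simp: u_def abs_mult)
    have "exp u \<le> 1 + u + u\<^sup>2 + exp (\<theta> * y) * \<bar>u\<bar> powr s"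
      using u assms by (intro exp_le_quadratic_plus_power) auto
    moreover have "u \<le> \<theta> * (x + x\<^sup>2 / y)"
      unfolding u_def using assms by (intro mult_left_mono clip_error_le) auto
    moreover have "u\<^sup>2 \<le> \<theta>\<^sup>2 * x\<^sup>2"
      using power_mono[OF u(2), of 2] by (simp add: power_mult_distrib)
    moreover have "exp (\<theta> * y) * \<bar>u\<bar> powr s \<le> exp (\<theta> * y) * (\<theta> powr s * \<bar>x\<bar> powr s)"
      using powr_mono2[OF _ _ u(2), of s] assms by (simp add: powr_mult)
    ultimately show ?thesis unfolding u_def by linarith
  qed
  have "expectation (\<lambda>\<omega>. exp (\<theta> * clip y (Y \<omega>)))
    \<le> expectation (\<lambda>\<omega>. 1 + \<theta> * (Y \<omega> + (Y \<omega>)\<^sup>2 / y) + \<theta>\<^sup>2 * (Y \<omega>)\<^sup>2 + exp (\<theta> * y) * \<theta> powr s * \<bar>Y \<omega>\<bar> powr s)"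
  proof (rule integral_mono)
    show "integrable M (\<lambda>\<omega>. exp (\<theta> * clip y (Y \<omega>)))"
    proof (rule integrable_bounded_function[of _ "exp (\<theta> * y)"])
      show "\<bar>exp (\<theta> * clip y (Y \<omega>))\<bar> \<le> exp (\<theta> * y)" for \<omega>
        using abs_clip_le[of y "Y \<omega>"] assms by auto
    qed measurable
  qed (use assms pt in auto)
  also have "\<dots> = 1 + (\<theta> * V / y + \<theta>\<^sup>2 * V + exp (\<theta> * y) * \<theta> powr s * B)"
    using assms by (simp add: prob_space)
  also have "\<dots> \<le> exp (\<theta> * V / y + \<theta>\<^sup>2 * V + exp (\<theta> * y) * \<theta> powr s * B)"
    by (rule exp_ge_add_one_self)
  finally show ?thesis .
qed

lemma clipped_sum_tail_le:
  assumes "0 < \<theta>" "0 < y" and mgf: "expectation (\<lambda>\<omega>. exp (\<theta> * clip y (Y \<omega>))) \<le> exp G"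
    and "0 \<le> G" "k \<le> n"
  shows "prob {\<omega>\<in>space M. t < (\<Sum>i\<in>{1..k}. clip y (X i \<omega>))} \<le> exp (- \<theta> * t + real n * G)"
proof -
  let ?g = "\<lambda>x. exp (\<theta> * clip y x)"
  let ?u = "\<lambda>\<omega>. \<Prod>i\<in>{1..k}. ?g (X i \<omega>)"
  have g: "mono ?g" "0 \<le> ?g x" "?g x \<le> exp (\<theta> * y)" for x
    using abs_clip_le[of y x] mono_clip[of y] assms by (auto simp: mono_def)
  have u [measurable]: "?u \<in> borel_measurable M" by (intro borel_measurable_prod) auto
  have u_eq: "?u \<omega> = exp (\<theta> * (\<Sum>i\<in>{1..k}. clip y (X i \<omega>)))" for \<omega>
    by (simp add: exp_sum sum_distrib_left)
  have u_int: "integrable M ?u"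
    using g by (intro integrable_bounded_function[of _ "exp (\<theta> * y) ^ k"] u)
      (auto simp: abs_prod prod_mono[of "{1..k}" _ "\<lambda>_. exp (\<theta> * y)", simplified])
  have "prob {\<omega>\<in>space M. t < (\<Sum>i\<in>{1..k}. clip y (X i \<omega>))} \<le> prob {\<omega>\<in>space M. exp (\<theta> * t) \<le> ?u \<omega>}"
    unfolding u_eq using assms by (intro finite_measure_mono) (auto simp flip: u_eq)
  also have "\<dots> \<le> expectation ?u / exp (\<theta> * t)"
    by (intro integral_Markov_inequality_measure[where A = "{}"] u_int) (auto intro!: prod_nonneg)
  also have "\<dots> \<le> (\<Prod>i\<in>{1..k}. expectation (\<lambda>\<omega>. ?g (X i \<omega>))) / exp (\<theta> * t)"
    using g by (intro divide_right_mono neg_assoc_expectation_prod_le[OF na X_measurable, where C = "exp (\<theta> * y)"]) auto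
  also have "(\<Prod>i\<in>{1..k}. expectation (\<lambda>\<omega>. ?g (X i \<omega>))) = (\<Prod>i\<in>{1..k}. expectation (\<lambda>\<omega>. ?g (Y \<omega>)))"
    by (intro prod.cong refl expectation_X) auto
  also have "\<dots> / exp (\<theta> * t) \<le> exp G ^ k / exp (\<theta> * t)"
    using mgf by (auto intro!: divide_right_mono power_mono integral_nonneg)
  also have "exp G ^ k = exp (real k * G)" by (simp add: exp_of_nat_mult)
  also have "exp (real k * G) / exp (\<theta> * t) \<le> exp (real n * G) / exp (\<theta> * t)"
    using assms by (auto intro!: divide_right_mono mult_right_mono)
  also have "exp (real n * G) / exp (\<theta> * t) = exp (- \<theta> * t + real n * G)" by (simp flip: exp_diff)
  finally show ?thesis by simp
qed

text \<open>If no summand exceeds \<open>y\<close> in absolute value then clipping changes none of them, and one of the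
  clipped sums (of \<open>X\<close> or of \<open>- X\<close>) exceeds \<open>t\<close>.  Then take union bounds over \<open>k\<close>.\<close>

lemma max_partial_sum_tail_le:
  assumes "1 \<le> n" "integrable M Y" "expectation Y = 0" "integrable M (\<lambda>\<omega>. (Y \<omega>)\<^sup>2)"
    and "integrable M (\<lambda>\<omega>. \<bar>Y \<omega>\<bar> powr s)" "0 \<le> s" "0 < \<theta>" "0 < y"
  defines "V \<equiv> expectation (\<lambda>\<omega>. (Y \<omega>)\<^sup>2)" and "B \<equiv> expectation (\<lambda>\<omega>. \<bar>Y \<omega>\<bar> powr s)"
  shows "prob {\<omega>\<in>space M. t < max_partial_sum X n \<omega>}
    \<le> real n * prob {\<omega>\<in>space M. y < \<bar>Y \<omega>\<bar>}
      + 2 * real n * exp (- \<theta> * t + real n * (\<theta> * V / y + \<theta>\<^sup>2 * V + exp (\<theta> * y) * \<theta> powr s * B))"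
proof -
  define G where "G = \<theta> * V / y + \<theta>\<^sup>2 * V + exp (\<theta> * y) * \<theta> powr s * B"
  have G: "0 \<le> G" using assms unfolding G_def V_def B_def by (auto intro!: add_nonneg_nonneg integral_nonneg)
  interpret neg: identically_distributed_NA M "\<lambda>n \<omega>. - X n \<omega>" "\<lambda>\<omega>. - Y \<omega>" by (rule uminus)
  define P where "P k = {\<omega>\<in>space M. t < (\<Sum>i\<in>{1..k}. clip y (X i \<omega>))}" for k
  define Q where "Q k = {\<omega>\<in>space M. t < (\<Sum>i\<in>{1..k}. clip y (- X i \<omega>))}" for k
  define T where "T k = {\<omega>\<in>space M. y < \<bar>X k \<omega>\<bar>}" for k
  have [measurable]: "P k \<in> events" "Q k \<in> events" for k
    unfolding P_def Q_def by (intro borel_measurable_less borel_measurable_sum; auto)+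
  have [measurable]: "T k \<in> events" if "k \<in> {1..n}" for k using that unfolding T_def by auto
  have mgf: "expectation (\<lambda>\<omega>. exp (\<theta> * clip y (Y \<omega>))) \<le> exp G"
    unfolding G_def V_def B_def by (rule clipped_mgf_le) (use assms in simp_all)
  have mgf': "expectation (\<lambda>\<omega>. exp (\<theta> * clip y (- Y \<omega>))) \<le> exp G"
    using neg.clipped_mgf_le[of s \<theta> y] assms unfolding G_def V_def B_def by simp
  have PQ: "prob (P k) \<le> exp (- \<theta> * t + real n * G)" "prob (Q k) \<le> exp (- \<theta> * t + real n * G)" if "k \<in> {1..n}" for k
    unfolding P_def Q_def
    using that clipped_sum_tail_le[OF \<open>0 < \<theta>\<close> \<open>0 < y\<close> mgf G, of k n t]
      neg.clipped_sum_tail_le[OF \<open>0 < \<theta>\<close> \<open>0 < y\<close> mgf' G, of k n t] by simp_all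
  have T: "prob (T k) = prob {\<omega>\<in>space M. y < \<bar>Y \<omega>\<bar>}" if "k \<in> {1..n}" for k
    using prob_X[of "{x. y < \<bar>x\<bar>}" k] that by (simp add: T_def)
  have sub: "{\<omega>\<in>space M. t < max_partial_sum X n \<omega>} \<subseteq> (\<Union>k\<in>{1..n}. T k \<union> (P k \<union> Q k))"
  proof
    fix \<omega> assume \<omega>: "\<omega> \<in> {\<omega>\<in>space M. t < max_partial_sum X n \<omega>}"
    then obtain k where k: "k \<in> {1..n}" "t < \<bar>partial_sum X k \<omega>\<bar>"
      using assms by (auto simp: less_max_partial_sum_iff)
    show "\<omega> \<in> (\<Union>k\<in>{1..n}. T k \<union> (P k \<union> Q k))"
    proof (cases "\<exists>i\<in>{1..n}. y < \<bar>X i \<omega>\<bar>")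
      case True
      then show ?thesis using \<omega> by (auto simp: T_def)
    next
      case False
      then have "(\<Sum>i\<in>{1..k}. clip y (X i \<omega>)) = partial_sum X k \<omega>"
        "(\<Sum>i\<in>{1..k}. clip y (- X i \<omega>)) = - partial_sum X k \<omega>"
        unfolding partial_sum_def sum_negf[symmetric] using k by (auto intro!: sum.cong clip_eq simp: not_less)
      then have "\<omega> \<in> P k \<union> Q k" using k \<omega> by (auto simp: P_def Q_def)
      then show ?thesis using k by blast
    qed
  qed
  have "prob {\<omega>\<in>space M. t < max_partial_sum X n \<omega>} \<le> prob (\<Union>k\<in>{1..n}. T k \<union> (P k \<union> Q k))"
    by (intro finite_measure_mono sub sets.finite_UN) auto
  also have "\<dots> \<le> (\<Sum>k\<in>{1..n}. prob (T k \<union> (P k \<union> Q k)))"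
    by (intro measure_UNION_le) auto
  also have "\<dots> \<le> (\<Sum>k\<in>{1..n}. prob {\<omega>\<in>space M. y < \<bar>Y \<omega>\<bar>} + 2 * exp (- \<theta> * t + real n * G))"
  proof (rule sum_mono)
    fix k assume k: "k \<in> {1..n}"
    have "prob (T k \<union> (P k \<union> Q k)) \<le> prob (T k) + prob (P k \<union> Q k)"
      using k by (intro measure_Un_le) auto
    also have "prob (P k \<union> Q k) \<le> prob (P k) + prob (Q k)" by (intro measure_Un_le) auto
    finally show "prob (T k \<union> (P k \<union> Q k)) \<le> prob {\<omega>\<in>space M. y < \<bar>Y \<omega>\<bar>} + 2 * exp (- \<theta> * t + real n * G)"
      using PQ[OF k] T[OF k] by simp
  qed
  finally show ?thesis by (simp add: G_def distrib_left)
qed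

end

section \<open>The exponential parameter\<close>

text \<open>With \<open>\<theta> = K ln (n z) / t\<close> the leading term of the exponent is \<open>- K ln (n z)\<close>, and the three
  corrections have to be absorbed.  The drift is bounded, because \<open>ln (n z) \<le> z ln n\<close> compensates
  \<open>n / t\<^sup>2 = 1 / (z\<^sup>2 ln n)\<close>.  The variance term is at most \<open>(K\<^sup>2 V / z) ln (n z)\<close>, hence at most one copy of
  \<open>ln (n z)\<close> as soon as \<open>z \<ge> K\<^sup>2 V\<close>.  For the last term, \<open>n \<theta>\<^sup>s\<close> gains the power \<open>(n z)\<^bsup>1-s/2\<^esup>\<close>, which
  is negative because \<open>s > 2\<close>; one half of it pays for \<open>exp (\<theta> y) = (n z)\<^bsup>K \<delta>\<^esup>\<close>, if \<open>\<delta>\<close> is small,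
  and the other half for the powers of \<open>ln (n z)\<close>.\<close>

lemma exponent_choice:
  fixes s V B K :: real
  assumes "2 < s" "0 \<le> V" "0 \<le> B" "0 < K"
  obtains \<delta> z0 C where "0 < \<delta>" "\<delta> \<le> 1" "1 \<le> z0"
    "\<And>n z. 3 \<le> n \<Longrightarrow> z0 \<le> z \<Longrightarrow>
      (let t = z * norming n; y = \<delta> * t; \<theta> = K * ln (real n * z) / t
       in - \<theta> * t + real n * (\<theta> * V / y + \<theta>\<^sup>2 * V + exp (\<theta> * y) * \<theta> powr s * B)
          \<le> C - (K - 1) * ln (real n * z))"
proof -
  define \<kappa> where "\<kappa> = (s / 2 - 1) / 2"
  define \<delta> where "\<delta> = min 1 (\<kappa> / K)"
  define b where "b = \<kappa> / s"
  define z0 where "z0 = max 1 (K\<^sup>2 * V)"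
  define C where "C = K * V / \<delta> + (K / b) powr s * B"
  have pos: "0 < \<kappa>" "0 < \<delta>" "0 < b" "\<delta> \<le> 1" using assms by (auto simp: \<kappa>_def \<delta>_def b_def)
  have K\<delta>: "K * \<delta> \<le> \<kappa>" using assms by (simp add: \<delta>_def min_def field_simps)
  show ?thesis
  proof (rule that[of \<delta> z0 C])
    fix n :: nat and z :: real
    assume n: "3 \<le> n" and z: "z0 \<le> z"
    define w where "w = norming n"
    define t where "t = z * w"
    define y where "y = \<delta> * t"
    define L where "L = ln (real n * z)"
    define \<theta> where "\<theta> = K * L / t"
    have z1: "1 \<le> z" and zV: "K\<^sup>2 * V \<le> z" using z by (auto simp: z0_def)
    have ln1: "1 \<le> ln (real n)" using n by (rule ln_ge_1)
    have w0: "0 < w" using n by (simp add: w_def norming_pos)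
    have w2: "w\<^sup>2 = real n * ln (real n)" by (simp add: w_def norming_sq)
    have t0: "0 < t" using z1 w0 by (simp add: t_def)
    have nz: "1 < real n * z" using n z1 by (intro less_1_mult') auto
    have L0: "0 < L" using nz by (simp add: L_def)
    have Lz: "L \<le> z * ln (real n)"
    proof -
      have "L = ln (real n) + ln z" using n z1 by (simp add: L_def ln_mult)
      also have "ln z \<le> (z - 1) * 1" using z1 ln_le_minus_one[of z] by simp
      also have "(z - 1) * 1 \<le> (z - 1) * ln (real n)" using z1 ln1 by (intro mult_left_mono) auto
      finally show ?thesis by (simp add: algebra_simps)
    qed
    have t2: "t\<^sup>2 = z\<^sup>2 * (real n * ln (real n))" by (simp add: t_def power_mult_distrib w2)
    have nt: "real n * (L / t\<^sup>2) \<le> 1 / z"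
    proof -
      have "real n * (L / t\<^sup>2) = L / (z\<^sup>2 * ln (real n))" using n by (simp add: t2)
      also have "\<dots> \<le> z * ln (real n) / (z\<^sup>2 * ln (real n))"
        using Lz z1 ln1 by (intro divide_right_mono) auto
      also have "\<dots> = 1 / z" using z1 ln1 by (simp add: power2_eq_square)
      finally show ?thesis .
    qed
    \<comment> \<open>the drift, the variance and the moment of order \<open>s\<close>, in this order\<close>
    have T1: "real n * (\<theta> * V / y) \<le> K * V / \<delta>"
    proof -
      have "real n * (\<theta> * V / y) = (K * V / \<delta>) * (real n * (L / t\<^sup>2))"
        by (simp add: \<theta>_def y_def power2_eq_square ac_simps)
      also have "\<dots> \<le> (K * V / \<delta>) * (1 / z)" using nt pos assms by (intro mult_left_mono) auto
      also have "\<dots> \<le> (K * V / \<delta>) * 1" using z1 pos assms by (intro mult_left_mono) auto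
      finally show ?thesis by simp
    qed
    have T2: "real n * (\<theta>\<^sup>2 * V) \<le> L"
    proof -
      have "real n * (\<theta>\<^sup>2 * V) = (K\<^sup>2 * V * L) * (real n * (L / t\<^sup>2))"
        by (simp add: \<theta>_def power2_eq_square)
      also have "\<dots> \<le> (K\<^sup>2 * V * L) * (1 / z)" using nt assms L0 by (intro mult_left_mono) auto
      also have "\<dots> = (K\<^sup>2 * V / z) * L" by simp
      also have "\<dots> \<le> 1 * L" using zV z1 L0 by (intro mult_right_mono) auto
      finally show ?thesis by simp
    qed
    have T3: "real n * (exp (\<theta> * y) * \<theta> powr s * B) \<le> (K / b) powr s * B"
    proof -
      let ?N = "real n * z"
      have "exp (\<theta> * y) = exp (K * \<delta> * L)" using t0 by (simp add: \<theta>_def y_def)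
      also have "\<dots> \<le> exp (\<kappa> * L)" using K\<delta> L0 by simp
      also have "\<dots> = ?N powr \<kappa>" using nz n z1 by (simp add: powr_def L_def)
      finally have e: "exp (\<theta> * y) \<le> ?N powr \<kappa>" .
      have Lb: "L \<le> ?N powr b / b" unfolding L_def using nz pos by (intro ln_powr_bound) auto
      have "?N powr (1/2) \<le> t"
      proof -
        have "?N * 1 \<le> ?N * (z * ln (real n))"
          using nz mult_mono[OF z1 ln1] z1 by (intro mult_left_mono) auto
        then have "?N \<le> t\<^sup>2" unfolding t2 by (simp add: power2_eq_square algebra_simps)
        then show ?thesis using t0 nz by (simp add: powr_half_sqrt real_le_lsqrt)
      qed
      then have "\<theta> \<le> K * (?N powr b / b) / ?N powr (1/2)"
        unfolding \<theta>_def using Lb L0 assms pos nz n z1 by (intro frac_le mult_left_mono) auto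
      also have "\<dots> = (K / b) * ?N powr (b - 1/2)" by (simp add: powr_diff)
      finally have "\<theta> powr s \<le> ((K / b) * ?N powr (b - 1/2)) powr s"
        using assms L0 t0 by (intro powr_mono2) (auto simp: \<theta>_def)
      also have "\<dots> = (K / b) powr s * ?N powr ((b - 1/2) * s)"
        by (simp only: powr_mult[of "K / b"] powr_powr)
      also have "(b - 1/2) * s = \<kappa> - s / 2" using assms by (simp add: b_def field_simps)
      finally have th: "\<theta> powr s \<le> (K / b) powr s * ?N powr (\<kappa> - s / 2)" .
      have "real n * (exp (\<theta> * y) * \<theta> powr s) \<le> ?N powr 1 * (?N powr \<kappa> * ((K / b) powr s * ?N powr (\<kappa> - s / 2)))"
        using e th z1 by (intro mult_mono) (auto simp: mult_le_cancel_left1)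
      also have "\<dots> = (K / b) powr s * (?N powr (1 + \<kappa> + (\<kappa> - s / 2)))"
        by (simp only: powr_add ac_simps)
      also have "1 + \<kappa> + (\<kappa> - s / 2) = 0" by (simp add: \<kappa>_def)
      also have "?N powr 0 = 1" using nz n z1 by simp
      finally have "real n * (exp (\<theta> * y) * \<theta> powr s) \<le> (K / b) powr s" by simp
      then have "real n * (exp (\<theta> * y) * \<theta> powr s) * B \<le> (K / b) powr s * B"
        using assms by (intro mult_right_mono) auto
      then show ?thesis by (simp add: mult.assoc)
    qed
    have "- \<theta> * t = - K * L" using t0 by (simp add: \<theta>_def)
    then have "- \<theta> * t + real n * (\<theta> * V / y + \<theta>\<^sup>2 * V + exp (\<theta> * y) * \<theta> powr s * B)
        \<le> C - (K - 1) * L"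
      using T1 T2 T3 by (simp add: C_def algebra_simps)
    then show "let t = z * norming n; y = \<delta> * t; \<theta> = K * ln (real n * z) / t
       in - \<theta> * t + real n * (\<theta> * V / y + \<theta>\<^sup>2 * V + exp (\<theta> * y) * \<theta> powr s * B)
          \<le> C - (K - 1) * ln (real n * z)"
      by (simp only: Let_def t_def y_def \<theta>_def L_def w_def)
  qed (use pos in \<open>auto simp: z0_def\<close>)
qed

section \<open>Moments and integrated tails of a single variable\<close>

lemma powr_less_iff_less_powr:
  fixes x u q :: real
  assumes "0 < x" "0 \<le> u" "0 < q"
  shows "x powr q < u \<longleftrightarrow> x < u powr (1 / q)"
proof
  assume "x powr q < u"
  then have "(x powr q) powr (1 / q) < u powr (1 / q)" using assms by (intro powr_less_mono2) auto
  then show "x < u powr (1 / q)" using assms by (simp add: powr_powr)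
next
  assume "x < u powr (1 / q)"
  then have "x powr q < (u powr (1 / q)) powr q" using assms by (intro powr_less_mono2) auto
  then show "x powr q < u" using assms by (simp add: powr_powr)
qed

lemma log_moment_eq:
  fixes y r :: real
  shows "\<bar>y\<bar> powr (2 * r) * log_plus \<bar>y\<bar> powr (- r) = (y\<^sup>2 / log_plus \<bar>y\<bar>) powr r"
proof (cases "y = 0")
  case False
  then have "\<bar>y\<bar> powr (2 * r) = (y\<^sup>2) powr r" by (simp add: powr_powr[symmetric])
  then show ?thesis using log_plus_pos[of "\<bar>y\<bar>"]
    by (simp add: powr_divide powr_minus field_simps)
qed simp

context prob_space
begin

lemma prob_tail_measurable [measurable]:
  fixes Z :: "'a \<Rightarrow> real" and w :: real
  assumes [measurable]: "Z \<in> borel_measurable M" and "0 \<le> w"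
  shows "(\<lambda>z. prob {\<omega>\<in>space M. z * w < Z \<omega>}) \<in> borel_measurable borel"
proof -
  have "mono (\<lambda>z. - prob {\<omega>\<in>space M. z * w < Z \<omega>})"
  proof (rule monoI)
    fix z z' :: real assume "z \<le> z'"
    then have "z * w \<le> z' * w" using assms by (intro mult_right_mono) auto
    then show "- prob {\<omega>\<in>space M. z * w < Z \<omega>} \<le> - prob {\<omega>\<in>space M. z' * w < Z \<omega>}"
      by (auto intro!: finite_measure_mono)
  qed
  then have "(\<lambda>z. - (- prob {\<omega>\<in>space M. z * w < Z \<omega>})) \<in> borel_measurable borel"
    by (intro borel_measurable_uminus borel_measurable_mono)
  then show ?thesis by simp
qed

text \<open>The layer-cake formula after the substitution that makes \<open>x\<^sup>q w < Z\<close> a condition on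
  \<open>(Z / w)\<^bsup>1/q\<^esup>\<close>.  It serves for the equivalence of (i) and (ii) and for the moments of \<open>X\<close>.\<close>

lemma nn_integral_power_tail:
  fixes Z :: "'a \<Rightarrow> real" and w q \<epsilon> :: real
  assumes [measurable]: "Z \<in> borel_measurable M" and Z: "\<And>\<omega>. 0 \<le> Z \<omega>"
    and "0 < w" "0 < q" "0 < \<epsilon>"
  shows "(\<integral>\<^sup>+x\<in>{\<epsilon>..}. ennreal (prob {\<omega>\<in>space M. x powr q * w < Z \<omega>}) \<partial>lborel)
    = (\<integral>\<^sup>+\<omega>. ennreal (max 0 ((Z \<omega> / w) powr (1 / q) - \<epsilon>)) \<partial>M)"
proof -
  have "(\<integral>\<^sup>+x\<in>{\<epsilon>..}. ennreal (prob {\<omega>\<in>space M. x powr q * w < Z \<omega>}) \<partial>lborel)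
    = (\<integral>\<^sup>+x\<in>{\<epsilon>..}. emeasure M {\<omega>\<in>space M. x < (Z \<omega> / w) powr (1 / q)} \<partial>lborel)"
  proof (rule nn_integral_cong)
    fix x :: real
    have "{\<omega>\<in>space M. x powr q * w < Z \<omega>} = {\<omega>\<in>space M. x < (Z \<omega> / w) powr (1 / q)}" if "\<epsilon> \<le> x"
      using assms that powr_less_iff_less_powr[of x "Z _ / w" q] by (auto simp: pos_less_divide_eq)
    then show "ennreal (prob {\<omega>\<in>space M. x powr q * w < Z \<omega>}) * indicator {\<epsilon>..} x
      = emeasure M {\<omega>\<in>space M. x < (Z \<omega> / w) powr (1 / q)} * indicator {\<epsilon>..} x"
      by (auto simp: indicator_def emeasure_eq_measure)
  qed
  also have "\<dots> = (\<integral>\<^sup>+\<omega>. ennreal (max 0 ((Z \<omega> / w) powr (1 / q) - \<epsilon>)) \<partial>M)"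
    by (rule layer_cake) (auto intro: sigma_finite_measure_axioms)
  finally show ?thesis .
qed

lemma integrable_abs_powr_mono:
  fixes Z :: "'a \<Rightarrow> real"
  assumes [measurable]: "Z \<in> borel_measurable M" and "integrable M (\<lambda>\<omega>. \<bar>Z \<omega>\<bar> powr a)" "0 \<le> b" "b \<le> a"
  shows "integrable M (\<lambda>\<omega>. \<bar>Z \<omega>\<bar> powr b)"
proof (rule Bochner_Integration.integrable_bound)
  show "integrable M (\<lambda>\<omega>. 1 + \<bar>Z \<omega>\<bar> powr a)" using assms by simp
  have "\<bar>z\<bar> powr b \<le> 1 + \<bar>z\<bar> powr a" for z :: real
  proof (cases "\<bar>z\<bar> \<le> 1")
    case True
    then have "\<bar>z\<bar> powr b \<le> 1" using assms by (intro powr_le1) auto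
    then show ?thesis by (smt (verit) powr_ge_zero)
  next
    case False
    then have "\<bar>z\<bar> powr b \<le> \<bar>z\<bar> powr a" using assms by (intro powr_mono) auto
    then show ?thesis by simp
  qed
  then show "AE \<omega> in M. norm (\<bar>Z \<omega>\<bar> powr b) \<le> norm (1 + \<bar>Z \<omega>\<bar> powr a)" by (simp add: abs_of_nonneg add_nonneg_nonneg)
qed measurable

text \<open>Since \<open>2 r > 1 + r\<close>, the factor \<open>(log\<^sup>+)\<^bsup>-r\<^esup>\<close> is outweighed by the surplus power
  \<open>\<bar>Z\<bar>\<^bsup>r-1\<^esup>\<close>; the order \<open>1 + r\<close> is still larger than \<open>2\<close>.\<close>

lemma integrable_of_log_moment:
  fixes Z :: "'a \<Rightarrow> real"
  assumes [measurable]: "Z \<in> borel_measurable M" and r: "1 < r"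
    and fin: "(\<integral>\<^sup>+\<omega>. ennreal (\<bar>Z \<omega>\<bar> powr (2 * r) * log_plus \<bar>Z \<omega>\<bar> powr (- r)) \<partial>M) < \<infinity>"
  shows "integrable M (\<lambda>\<omega>. \<bar>Z \<omega>\<bar> powr (1 + r))"
proof -
  define a where "a = (r - 1) / r"
  have a: "0 < a" "a * r = r - 1" using r by (auto simp: a_def)
  define C where "C = (1 + 1 / a) powr r"
  have C: "0 \<le> C" by (simp add: C_def)
  show ?thesis
  proof (rule Bochner_Integration.integrable_bound)
    have "integrable M (\<lambda>\<omega>. \<bar>Z \<omega>\<bar> powr (2 * r) * log_plus \<bar>Z \<omega>\<bar> powr (- r))"
      using fin by (intro integrableI_nonneg) auto
    then show "integrable M (\<lambda>\<omega>. 1 + C * (\<bar>Z \<omega>\<bar> powr (2 * r) * log_plus \<bar>Z \<omega>\<bar> powr (- r)))" by simp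
    have "\<bar>z\<bar> powr (1 + r) \<le> 1 + C * (\<bar>z\<bar> powr (2 * r) * log_plus \<bar>z\<bar> powr (- r))" for z :: real
    proof (cases "\<bar>z\<bar> \<le> 1")
      case True
      then have "\<bar>z\<bar> powr (1 + r) \<le> 1" using r by (intro powr_le1) auto
      moreover have "0 \<le> C * (\<bar>z\<bar> powr (2 * r) * log_plus \<bar>z\<bar> powr (- r))" using C by simp
      ultimately show ?thesis by linarith
    next
      case False
      have "log_plus \<bar>z\<bar> powr r \<le> ((1 + 1 / a) * \<bar>z\<bar> powr a) powr r"
        using False a r log_plus_pos[of "\<bar>z\<bar>"] by (intro powr_mono2 log_plus_le_powr) auto
      also have "\<dots> = C * \<bar>z\<bar> powr (r - 1)" using a by (simp add: powr_mult powr_powr C_def)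
      finally have "log_plus \<bar>z\<bar> powr r * \<bar>z\<bar> powr (1 + r) \<le> C * \<bar>z\<bar> powr (r - 1) * \<bar>z\<bar> powr (1 + r)"
        by (intro mult_right_mono) auto
      also have "\<dots> = C * \<bar>z\<bar> powr (2 * r)" by (simp add: mult.assoc powr_add[symmetric])
      finally have "\<bar>z\<bar> powr (1 + r) \<le> C * (\<bar>z\<bar> powr (2 * r) * log_plus \<bar>z\<bar> powr (- r))"
        using log_plus_pos[of "\<bar>z\<bar>"] by (simp add: powr_minus field_simps)
      then show ?thesis by simp
    qed
    then show "AE \<omega> in M. norm (\<bar>Z \<omega>\<bar> powr (1 + r))
        \<le> norm (1 + C * (\<bar>Z \<omega>\<bar> powr (2 * r) * log_plus \<bar>Z \<omega>\<bar> powr (- r)))"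
      using C by (simp add: abs_of_nonneg add_nonneg_nonneg)
  qed measurable
qed

text \<open>The contribution of single large summands to the tail series: \<open>n P (\<bar>Z\<bar> > z w\<^sub>n)\<close> stands in
  for the probability that one of \<open>n\<close> copies of \<open>Z\<close> exceeds \<open>z w\<^sub>n\<close>.\<close>

definition tail_sum :: "('a \<Rightarrow> real) \<Rightarrow> real \<Rightarrow> real \<Rightarrow> ennreal" where
  "tail_sum Z r z = (\<Sum>n. ennreal (real n powr (r - 1) * prob {\<omega>\<in>space M. z * norming n < \<bar>Z \<omega>\<bar>}) * indicator {3..} n)"

lemma tail_sum_measurable [measurable]:
  assumes [measurable]: "Z \<in> borel_measurable M"
  shows "tail_sum Z r \<in> borel_measurable borel"
  unfolding tail_sum_def[abs_def] using norming_nonneg by measurable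

text \<open>For \<open>p = 1/q \<ge> 2 r\<close> the integral is taken first: it turns the \<open>n\<close>-th tail into at most
  \<open>(\<delta> w\<^sub>n)\<^bsup>-p\<^esup> E \<bar>Z\<bar>\<^sup>p\<close>, and \<open>n\<^bsup>r-1\<^esup> w\<^sub>n\<^bsup>-p\<^esup>\<close> is summable.\<close>

lemma tail_sum_integral_high_power:
  fixes Z :: "'a \<Rightarrow> real"
  assumes [measurable]: "Z \<in> borel_measurable M" and r: "1 < r" and q: "0 < q" "q \<le> 1 / (2 * r)"
    and fin: "(\<integral>\<^sup>+\<omega>. ennreal (\<bar>Z \<omega>\<bar> powr (1 / q)) \<partial>M) < \<infinity>" and \<delta>: "0 < \<delta>" and \<epsilon>: "0 < \<epsilon>"
  shows "(\<integral>\<^sup>+x\<in>{\<epsilon>..}. tail_sum Z r (\<delta> * x powr q) \<partial>lborel) < \<infinity>"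
proof -
  define E where "E = (\<integral>\<^sup>+\<omega>. ennreal (\<bar>Z \<omega>\<bar> powr (1 / q)) \<partial>M)"
  define h where "h n = real n powr (r - 1) * norming n powr (- (1 / q))" for n
  have "2 * r \<le> 1 / q" using r q by (simp add: field_simps)
  then have h: "summable h" unfolding h_def[abs_def] by (rule summable_norming_powr[OF r])
  define t where "t n x = ennreal (real n powr (r - 1) * prob {\<omega>\<in>space M. \<delta> * x powr q * norming n < \<bar>Z \<omega>\<bar>}) * indicator {3..} n" for n x
  have pm [measurable]: "(\<lambda>x. prob {\<omega>\<in>space M. \<delta> * x powr q * norming n < \<bar>Z \<omega>\<bar>}) \<in> borel_measurable borel" for n
    using norming_nonneg[of n] by (intro measurable_compose[OF _ prob_tail_measurable]) measurable
  have "(\<integral>\<^sup>+x\<in>{\<epsilon>..}. tail_sum Z r (\<delta> * x powr q) \<partial>lborel) = (\<integral>\<^sup>+x. (\<Sum>n. t n x * indicator {\<epsilon>..} x) \<partial>lborel)"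
    by (simp add: tail_sum_def t_def)
  also have "\<dots> = (\<Sum>n. \<integral>\<^sup>+x. t n x * indicator {\<epsilon>..} x \<partial>lborel)"
    by (rule nn_integral_suminf) (unfold t_def, measurable)
  also have "\<dots> \<le> (\<Sum>n. ennreal (h n) * (ennreal (\<delta> powr (- (1 / q))) * E))"
  proof (intro suminf_le summableI)
    fix n
    show "(\<integral>\<^sup>+x. t n x * indicator {\<epsilon>..} x \<partial>lborel) \<le> ennreal (h n) * (ennreal (\<delta> powr (- (1 / q))) * E)"
    proof (cases "3 \<le> n")
      case True
      then have w: "0 < norming n" by (intro norming_pos) auto
      have "(\<integral>\<^sup>+x. t n x * indicator {\<epsilon>..} x \<partial>lborel)
          = (\<integral>\<^sup>+x. ennreal (real n powr (r - 1)) * (ennreal (prob {\<omega>\<in>space M. x powr q * (\<delta> * norming n) < \<bar>Z \<omega>\<bar>}) * indicator {\<epsilon>..} x) \<partial>lborel)"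
        using True by (intro nn_integral_cong) (simp add: t_def ennreal_mult ac_simps)
      also have "\<dots> = ennreal (real n powr (r - 1)) * (\<integral>\<^sup>+x\<in>{\<epsilon>..}. ennreal (prob {\<omega>\<in>space M. x powr q * (\<delta> * norming n) < \<bar>Z \<omega>\<bar>}) \<partial>lborel)"
        using pm[of n] by (intro nn_integral_cmult) (simp add: ac_simps)
      also have "(\<integral>\<^sup>+x\<in>{\<epsilon>..}. ennreal (prob {\<omega>\<in>space M. x powr q * (\<delta> * norming n) < \<bar>Z \<omega>\<bar>}) \<partial>lborel)
          = (\<integral>\<^sup>+\<omega>. ennreal (max 0 ((\<bar>Z \<omega>\<bar> / (\<delta> * norming n)) powr (1 / q) - \<epsilon>)) \<partial>M)"
        using w \<delta> q \<epsilon> by (intro nn_integral_power_tail) auto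
      also have "\<dots> \<le> (\<integral>\<^sup>+\<omega>. ennreal ((\<delta> * norming n) powr (- (1 / q))) * ennreal (\<bar>Z \<omega>\<bar> powr (1 / q)) \<partial>M)"
        using w \<delta> \<epsilon> by (intro nn_integral_mono) (simp add: ennreal_mult[symmetric] powr_divide powr_minus field_simps)
      also have "\<dots> = ennreal ((\<delta> * norming n) powr (- (1 / q))) * E"
        unfolding E_def by (intro nn_integral_cmult) measurable
      also have "ennreal (real n powr (r - 1)) * (ennreal ((\<delta> * norming n) powr (- (1 / q))) * E) = ennreal (h n) * (ennreal (\<delta> powr (- (1 / q))) * E)"
        using w \<delta> by (simp add: h_def powr_mult ennreal_mult ac_simps)
      finally show ?thesis by (simp add: mult_left_mono)
    qed (simp add: t_def)
  qed
  also have "\<dots> = ennreal (\<Sum>n. h n) * (ennreal (\<delta> powr (- (1 / q))) * E)"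
  proof -
    have "(\<Sum>n. ennreal (h n)) = ennreal (\<Sum>n. h n)"
      by (rule suminf_ennreal2[OF _ h]) (simp add: h_def)
    then show ?thesis by simp
  qed
  also have "\<dots> < \<infinity>" using fin by (simp add: E_def ennreal_mult_less_top)
  finally show ?thesis .
qed

text \<open>Exchange sum and expectation, and count the indices with \<open>w\<^sub>n < \<bar>Z\<bar> / z\<close>.\<close>

lemma tail_sum_le:
  fixes Z :: "'a \<Rightarrow> real"
  assumes [measurable]: "Z \<in> borel_measurable M" and r: "1 < r" and z: "0 < z"
  shows "tail_sum Z r z \<le> (\<integral>\<^sup>+\<omega>. ennreal ((3 * ((\<bar>Z \<omega>\<bar> / z)\<^sup>2 / log_plus (\<bar>Z \<omega>\<bar> / z))) powr r) \<partial>M)"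
proof -
  have "tail_sum Z r z = (\<Sum>n. \<integral>\<^sup>+\<omega>. ennreal (real n powr (r - 1)) * indicator {n. 3 \<le> n \<and> norming n < \<bar>Z \<omega>\<bar> / z} n \<partial>M)"
    unfolding tail_sum_def
  proof (intro arg_cong[where f = suminf] ext)
    fix n
    have "(\<integral>\<^sup>+\<omega>. ennreal (real n powr (r - 1)) * indicator {n. 3 \<le> n \<and> norming n < \<bar>Z \<omega>\<bar> / z} n \<partial>M)
      = (\<integral>\<^sup>+\<omega>. (ennreal (real n powr (r - 1)) * indicator {3..} n) * indicator {\<omega>\<in>space M. z * norming n < \<bar>Z \<omega>\<bar>} \<omega> \<partial>M)"
      using z by (intro nn_integral_cong) (auto simp: indicator_def field_simps)
    also have "\<dots> = (ennreal (real n powr (r - 1)) * indicator {3..} n) * emeasure M {\<omega>\<in>space M. z * norming n < \<bar>Z \<omega>\<bar>}"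
      by (intro nn_integral_cmult_indicator) measurable
    finally show "ennreal (real n powr (r - 1) * prob {\<omega>\<in>space M. z * norming n < \<bar>Z \<omega>\<bar>}) * indicator {3..} n
        = (\<integral>\<^sup>+\<omega>. ennreal (real n powr (r - 1)) * indicator {n. 3 \<le> n \<and> norming n < \<bar>Z \<omega>\<bar> / z} n \<partial>M)"
      by (simp add: emeasure_eq_measure ennreal_mult ac_simps)
  qed
  also have "\<dots> = (\<integral>\<^sup>+\<omega>. (\<Sum>n. ennreal (real n powr (r - 1)) * indicator {n. 3 \<le> n \<and> norming n < \<bar>Z \<omega>\<bar> / z} n) \<partial>M)"
    by (rule nn_integral_suminf[symmetric]) (simp add: indicator_def, measurable)
  also have "\<dots> \<le> (\<integral>\<^sup>+\<omega>. ennreal ((3 * ((\<bar>Z \<omega>\<bar> / z)\<^sup>2 / log_plus (\<bar>Z \<omega>\<bar> / z))) powr r) \<partial>M)"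
  proof (rule nn_integral_mono)
    fix \<omega>
    show "(\<Sum>n. ennreal (real n powr (r - 1)) * indicator {n. 3 \<le> n \<and> norming n < \<bar>Z \<omega>\<bar> / z} n)
      \<le> ennreal ((3 * ((\<bar>Z \<omega>\<bar> / z)\<^sup>2 / log_plus (\<bar>Z \<omega>\<bar> / z))) powr r)"
    proof (cases "Z \<omega> = 0")
      case True
      then have "{n. 3 \<le> n \<and> norming n < \<bar>Z \<omega>\<bar> / z} = {}" using norming_nonneg by (auto simp: not_less)
      then show ?thesis by simp
    next
      case False
      then show ?thesis using r z by (intro sum_powr_norming_le) auto
    qed
  qed
  finally show ?thesis .
qed

text \<open>For \<open>p < 2 r\<close> the sum is taken first, for fixed \<open>x\<close>.  By \<open>log_plus_mult_le\<close> the
  counting bound at \<open>\<bar>Z\<bar> / (\<delta> z)\<close> is at most \<open>z\<^bsup>a r - 2 r\<^esup>\<close> times the logarithmic moment, up to a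
  constant, with an arbitrarily small \<open>a > 0\<close>.  With \<open>z = x\<^sup>q\<close> this is integrable because \<open>2 r q > 1\<close>.\<close>

lemma tail_sum_integral_low_power:
  fixes Z :: "'a \<Rightarrow> real"
  assumes [measurable]: "Z \<in> borel_measurable M" and r: "1 < r" and q: "0 < q" "1 / (2 * r) < q"
    and fin: "(\<integral>\<^sup>+\<omega>. ennreal (\<bar>Z \<omega>\<bar> powr (2 * r) * log_plus \<bar>Z \<omega>\<bar> powr (- r)) \<partial>M) < \<infinity>"
    and \<delta>: "0 < \<delta>" "\<delta> \<le> 1" and \<epsilon>: "1 \<le> \<epsilon>"
  shows "(\<integral>\<^sup>+x\<in>{\<epsilon>..}. tail_sum Z r (\<delta> * x powr q) \<partial>lborel) < \<infinity>"
proof -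
  define E where "E = (\<integral>\<^sup>+\<omega>. ennreal (((Z \<omega>)\<^sup>2 / log_plus \<bar>Z \<omega>\<bar>) powr r) \<partial>M)"
  have E: "E < \<infinity>" using fin by (simp add: E_def log_moment_eq)
  have rq: "1 < 2 * r * q" using r q by (simp add: field_simps)
  \<comment> \<open>This \<open>a\<close> uses up half of the gap between \<open>2 r q\<close> and \<open>1\<close>.\<close>
  define a where "a = (2 * r * q - 1) / (2 * r * q)"
  have a: "0 < a" unfolding a_def using rq by (intro divide_pos_pos) linarith+
  define e where "e = q * (a * r - 2 * r)"
  have "a * (2 * r * q) = 2 * r * q - 1" using r q by (simp add: a_def)
  then have "e = - (r * q) - 1 / 2" by (simp add: e_def algebra_simps)
  then have e: "e < - 1" using rq by simp
  define C where "C = (6 * (1 + 1 / a) / \<delta>\<^sup>2) powr r"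
  have le: "tail_sum Z r (\<delta> * x powr q) \<le> ennreal C * E * ennreal (x powr e)" if x: "1 \<le> x" for x
  proof -
    define z where "z = x powr q"
    have z: "1 \<le> z" using x q by (simp add: z_def ge_one_powr_ge_zero)
    have "tail_sum Z r (\<delta> * z) \<le> (\<integral>\<^sup>+\<omega>. ennreal ((3 * ((\<bar>Z \<omega>\<bar> / (\<delta> * z))\<^sup>2 / log_plus (\<bar>Z \<omega>\<bar> / (\<delta> * z)))) powr r) \<partial>M)"
      using r z \<delta> by (intro tail_sum_le) auto
    also have "\<dots> \<le> (\<integral>\<^sup>+\<omega>. ennreal (C * x powr e) * ennreal (((Z \<omega>)\<^sup>2 / log_plus \<bar>Z \<omega>\<bar>) powr r) \<partial>M)"
    proof (rule nn_integral_mono)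
      fix \<omega>
      define v where "v = \<bar>Z \<omega>\<bar> / (\<delta> * z)"
      have \<delta>z: "0 < \<delta> * z" "\<delta> * z \<le> z" using \<delta> z by (auto simp: mult_le_cancel_right1)
      have Zv: "\<bar>Z \<omega>\<bar> = v * (\<delta> * z)" using \<delta> z by (simp add: v_def)
      have "(3 * (v\<^sup>2 / log_plus v)) powr r \<le> C * x powr e * ((Z \<omega>)\<^sup>2 / log_plus \<bar>Z \<omega>\<bar>) powr r"
      proof (cases "Z \<omega> = 0")
        case True
        then show ?thesis by (simp add: v_def)
      next
        case False
        then have v: "0 < v" using \<delta>z by (simp add: v_def)
        have "log_plus \<bar>Z \<omega>\<bar> \<le> 2 * log_plus v * log_plus (\<delta> * z)"
          unfolding Zv by (rule log_plus_mult_le[OF v \<delta>z(1)])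
        also have "\<dots> \<le> 2 * log_plus v * ((1 + 1 / a) * z powr a)"
          using log_plus_mono[OF \<delta>z(2)] log_plus_le_powr[OF z a] log_plus_pos[of v]
          by (intro mult_left_mono) auto
        finally have l: "log_plus \<bar>Z \<omega>\<bar> \<le> 2 * log_plus v * ((1 + 1 / a) * z powr a)" .
        have "1 / log_plus v \<le> 2 * ((1 + 1 / a) * z powr a) / log_plus \<bar>Z \<omega>\<bar>"
          using l log_plus_pos[of v] log_plus_pos[of "\<bar>Z \<omega>\<bar>"] by (simp add: field_simps)
        then have "3 * v\<^sup>2 * (1 / log_plus v) \<le> 3 * v\<^sup>2 * (2 * ((1 + 1 / a) * z powr a) / log_plus \<bar>Z \<omega>\<bar>)"
          by (intro mult_left_mono) auto
        also have "\<dots> = (6 * (1 + 1 / a) / \<delta>\<^sup>2) * (z powr a / z powr 2) * ((Z \<omega>)\<^sup>2 / log_plus \<bar>Z \<omega>\<bar>)"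
          using z by (simp add: v_def power_divide power_mult_distrib)
        also have "z powr a / z powr 2 = x powr (q * (a - 2))"
          using x by (simp add: z_def powr_powr powr_diff[symmetric] right_diff_distrib)
        finally have "(3 * (v\<^sup>2 / log_plus v)) powr r \<le> ((6 * (1 + 1 / a) / \<delta>\<^sup>2) * x powr (q * (a - 2)) * ((Z \<omega>)\<^sup>2 / log_plus \<bar>Z \<omega>\<bar>)) powr r"
          using r log_plus_pos[of v] by (intro powr_mono2) auto
        also have "\<dots> = C * x powr e * ((Z \<omega>)\<^sup>2 / log_plus \<bar>Z \<omega>\<bar>) powr r"
        proof -
          have "(x powr (q * (a - 2))) powr r = x powr e" by (simp add: powr_powr e_def algebra_simps)
          then show ?thesis by (simp only: powr_mult C_def)
        qed
        finally show ?thesis .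
      qed
      then show "ennreal ((3 * ((\<bar>Z \<omega>\<bar> / (\<delta> * z))\<^sup>2 / log_plus (\<bar>Z \<omega>\<bar> / (\<delta> * z)))) powr r)
        \<le> ennreal (C * x powr e) * ennreal (((Z \<omega>)\<^sup>2 / log_plus \<bar>Z \<omega>\<bar>) powr r)"
        by (simp add: v_def C_def ennreal_mult[symmetric])
    qed
    also have "\<dots> = ennreal (C * x powr e) * E" unfolding E_def by (intro nn_integral_cmult) measurable
    finally show ?thesis by (simp add: z_def C_def ennreal_mult ac_simps)
  qed
  have "(\<integral>\<^sup>+x\<in>{\<epsilon>..}. tail_sum Z r (\<delta> * x powr q) \<partial>lborel) \<le> (\<integral>\<^sup>+x. (ennreal C * E) * (ennreal (x powr e) * indicator {\<epsilon>..} x) \<partial>lborel)"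
    using le \<epsilon> by (intro nn_integral_mono) (auto simp: indicator_def)
  also have "\<dots> = (ennreal C * E) * (\<integral>\<^sup>+x\<in>{\<epsilon>..}. ennreal (x powr e) \<partial>lborel)"
    by (intro nn_integral_cmult) measurable
  also have "\<dots> < \<infinity>"
    using E nn_integral_powr_to_inf[OF e, of \<epsilon>] \<epsilon> by (simp add: ennreal_mult_less_top)
  finally show ?thesis .
qed

end

section \<open>Excess moments and the tail series\<close>

context identically_distributed_NA
begin

lemma tail_series_eq:
  "tail_series M X r z = (\<Sum>n. ennreal (real n powr (r - 2) * prob {\<omega>\<in>space M. z * norming n < max_partial_sum X n \<omega>}) * indicator {3..} n)"
  unfolding tail_series_def infsum_atLeast_eq_suminf max_partial_sum_def norming_def ..

lemma tail_prob_antimono: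
  assumes "z \<le> z'" "1 \<le> n"
  shows "prob {\<omega>\<in>space M. z' * norming n < max_partial_sum X n \<omega>} \<le> prob {\<omega>\<in>space M. z * norming n < max_partial_sum X n \<omega>}"
proof -
  have "z * norming n \<le> z' * norming n" using assms norming_nonneg by (intro mult_right_mono) auto
  then show ?thesis using assms by (intro finite_measure_mono) auto
qed

lemma tail_series_antimono: "z \<le> z' \<Longrightarrow> tail_series M X r z' \<le> tail_series M X r z"
  unfolding tail_series_eq
  by (intro suminf_le summableI) (auto simp: indicator_def intro!: ennreal_leI mult_left_mono tail_prob_antimono)

text \<open>Scaling by \<open>w\<^sub>n\<close> turns the coefficient of the \<open>n\<close>-th excess moment into \<open>n\<^bsup>r-2\<^esup>\<close>, and the layer-cake
  formula is applied to each \<open>n\<close>.\<close>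

lemma sum_excess_moments_eq_integral_tail_series:
  assumes q: "0 < q" and \<epsilon>: "0 < \<epsilon>"
  shows "(\<Sum>\<^sub>\<infinity>n\<in>{3..}. ennreal (real n powr (r - 2 - 1 / (2 * q)) * ln (real n) powr (- 1 / (2 * q))) *
         (\<integral>\<^sup>+\<omega>. ennreal (max 0
            ((MAX k\<in>{1..n}. \<bar>partial_sum X k \<omega>\<bar> powr (1 / q))
              - \<epsilon> * (real n * ln (real n)) powr (1 / (2 * q)))) \<partial>M))
    = (\<integral>\<^sup>+x\<in>{\<epsilon>..}. tail_series M X r (x powr q) \<partial>lborel)"
proof -
  define g where "g n x = ennreal (real n powr (r - 2) * prob {\<omega>\<in>space M. x powr q * norming n < max_partial_sum X n \<omega>}) * indicator {3..} n * indicator {\<epsilon>..} x" for n x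
  have pm: "(\<lambda>x. prob {\<omega>\<in>space M. x powr q * norming n < max_partial_sum X n \<omega>}) \<in> borel_measurable borel" if "3 \<le> n" for n
    using that norming_nonneg[of n]
    by (intro measurable_compose[OF _ prob_tail_measurable, of "\<lambda>x. x powr q"]) auto
  have gm: "g n \<in> borel_measurable lborel" for n
  proof (cases "3 \<le> n")
    case True
    note [measurable] = pm[OF True]
    show ?thesis unfolding g_def[abs_def] by measurable
  qed (simp add: g_def[abs_def])
  have g_int: "(\<integral>\<^sup>+x. g n x \<partial>lborel)
      = ennreal (real n powr (r - 2 - 1 / (2 * q)) * ln (real n) powr (- 1 / (2 * q))) *
         (\<integral>\<^sup>+\<omega>. ennreal (max 0
            ((MAX k\<in>{1..n}. \<bar>partial_sum X k \<omega>\<bar> powr (1 / q))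
              - \<epsilon> * (real n * ln (real n)) powr (1 / (2 * q)))) \<partial>M) * indicator {3..} n" for n
  proof (cases "3 \<le> n")
    case True
    note [measurable] = pm[OF True]
    have n: "1 \<le> n" using True by simp
    have [measurable]: "max_partial_sum X n \<in> borel_measurable M" using n by measurable
    have w: "0 < norming n" using True by (intro norming_pos) auto
    have M0: "0 \<le> max_partial_sum X n \<omega>" for \<omega>
      using abs_le_max_partial_sum(2)[of 1 n X \<omega>] n by (auto intro: order_trans[OF abs_ge_zero])
    \<comment> \<open>The power may be taken after the maximum; \<open>max 0\<close> only makes it monotone on all reals.\<close>
    have Mp: "(MAX k\<in>{1..n}. \<bar>partial_sum X k \<omega>\<bar> powr (1 / q)) = max_partial_sum X n \<omega> powr (1 / q)" for \<omega>
    proof -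
      let ?h = "\<lambda>x :: real. max 0 x powr (1 / q)"
      have "mono ?h" using q by (auto intro!: monoI powr_mono2)
      then have "?h (max_partial_sum X n \<omega>) = Max (?h ` (\<lambda>k. \<bar>partial_sum X k \<omega>\<bar>) ` {1..n})"
        unfolding max_partial_sum_def using n by (intro mono_Max_commute) auto
      then show ?thesis using M0 by (simp add: image_image)
    qed
    have wp: "(real n * ln (real n)) powr (1 / (2 * q)) = norming n powr (1 / q)"
      using n by (simp add: norming_powr powr_mult mult.commute)
    have "(\<integral>\<^sup>+x. g n x \<partial>lborel)
        = (\<integral>\<^sup>+x. ennreal (real n powr (r - 2)) * (ennreal (prob {\<omega>\<in>space M. x powr q * norming n < max_partial_sum X n \<omega>}) * indicator {\<epsilon>..} x) \<partial>lborel)"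
      using True by (intro nn_integral_cong) (simp add: g_def ennreal_mult ac_simps)
    also have "\<dots> = ennreal (real n powr (r - 2)) * (\<integral>\<^sup>+x\<in>{\<epsilon>..}. ennreal (prob {\<omega>\<in>space M. x powr q * norming n < max_partial_sum X n \<omega>}) \<partial>lborel)"
      by (intro nn_integral_cmult) measurable
    also have "(\<integral>\<^sup>+x\<in>{\<epsilon>..}. ennreal (prob {\<omega>\<in>space M. x powr q * norming n < max_partial_sum X n \<omega>}) \<partial>lborel)
        = (\<integral>\<^sup>+\<omega>. ennreal (max 0 ((max_partial_sum X n \<omega> / norming n) powr (1 / q) - \<epsilon>)) \<partial>M)"
      using w q \<epsilon> M0 by (intro nn_integral_power_tail) auto
    also have "\<dots> = (\<integral>\<^sup>+\<omega>. ennreal (norming n powr (- (1 / q))) * ennreal (max 0 (max_partial_sum X n \<omega> powr (1 / q) - \<epsilon> * norming n powr (1 / q))) \<partial>M)"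
    proof (rule nn_integral_cong)
      fix \<omega>
      have "(max_partial_sum X n \<omega> / norming n) powr (1 / q) - \<epsilon>
          = norming n powr (- (1 / q)) * (max_partial_sum X n \<omega> powr (1 / q) - \<epsilon> * norming n powr (1 / q))"
        using w M0[of \<omega>] by (simp add: powr_divide powr_minus field_simps)
      then have "max 0 ((max_partial_sum X n \<omega> / norming n) powr (1 / q) - \<epsilon>)
          = norming n powr (- (1 / q)) * max 0 (max_partial_sum X n \<omega> powr (1 / q) - \<epsilon> * norming n powr (1 / q))"
        by (simp add: max_mult_distrib_left)
      then show "ennreal (max 0 ((max_partial_sum X n \<omega> / norming n) powr (1 / q) - \<epsilon>))
        = ennreal (norming n powr (- (1 / q))) * ennreal (max 0 (max_partial_sum X n \<omega> powr (1 / q) - \<epsilon> * norming n powr (1 / q)))"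
        by (simp add: ennreal_mult)
    qed
    also have "\<dots> = ennreal (norming n powr (- (1 / q))) * (\<integral>\<^sup>+\<omega>. ennreal (max 0 (max_partial_sum X n \<omega> powr (1 / q) - \<epsilon> * norming n powr (1 / q))) \<partial>M)"
      by (intro nn_integral_cmult) measurable
    also have "ennreal (real n powr (r - 2)) * \<dots> = ennreal (real n powr (r - 2) * norming n powr (- (1 / q))) * (\<integral>\<^sup>+\<omega>. ennreal (max 0 (max_partial_sum X n \<omega> powr (1 / q) - \<epsilon> * norming n powr (1 / q))) \<partial>M)"
      by (simp add: ennreal_mult mult.assoc)
    also have "real n powr (r - 2) * norming n powr (- (1 / q)) = real n powr (r - 2 - 1 / (2 * q)) * ln (real n) powr (- 1 / (2 * q))"
      using n by (simp add: norming_powr powr_add[symmetric] mult.assoc[symmetric] mult.commute[of q 2])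
    finally show ?thesis using True by (simp only: Mp wp) simp
  qed (simp add: g_def)
  have "(\<integral>\<^sup>+x\<in>{\<epsilon>..}. tail_series M X r (x powr q) \<partial>lborel) = (\<integral>\<^sup>+x. (\<Sum>n. g n x) \<partial>lborel)"
    by (simp add: tail_series_eq g_def)
  also have "\<dots> = (\<Sum>n. \<integral>\<^sup>+x. g n x \<partial>lborel)"
    by (rule nn_integral_suminf[OF gm])
  finally show ?thesis unfolding g_int infsum_atLeast_eq_suminf by simp
qed

section \<open>From moments to the tail series\<close>

lemma max_partial_sum_polynomial_tail:
  assumes "integrable M Y" "expectation Y = 0" "integrable M (\<lambda>\<omega>. (Y \<omega>)\<^sup>2)"
    and "integrable M (\<lambda>\<omega>. \<bar>Y \<omega>\<bar> powr s)" "2 < s" "0 < K"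
  obtains \<delta> z0 C where "0 < \<delta>" "\<delta> \<le> 1" "1 \<le> z0" "0 \<le> C"
    "\<And>n z. 3 \<le> n \<Longrightarrow> z0 \<le> z \<Longrightarrow> prob {\<omega>\<in>space M. z * norming n < max_partial_sum X n \<omega>}
      \<le> real n * prob {\<omega>\<in>space M. \<delta> * z * norming n < \<bar>Y \<omega>\<bar>} + C * real n * (real n * z) powr (- (K - 1))"
proof -
  define V B where "V = expectation (\<lambda>\<omega>. (Y \<omega>)\<^sup>2)" and "B = expectation (\<lambda>\<omega>. \<bar>Y \<omega>\<bar> powr s)"
  have "0 \<le> V" "0 \<le> B" by (auto simp: V_def B_def)
  from exponent_choice[OF \<open>2 < s\<close> this \<open>0 < K\<close>] obtain \<delta> z0 C where *: "0 < \<delta>" "\<delta> \<le> 1" "1 \<le> z0"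
    and ex: "\<And>n z. 3 \<le> n \<Longrightarrow> z0 \<le> z \<Longrightarrow>
      (let t = z * norming n; y = \<delta> * t; \<theta> = K * ln (real n * z) / t
       in - \<theta> * t + real n * (\<theta> * V / y + \<theta>\<^sup>2 * V + exp (\<theta> * y) * \<theta> powr s * B)
          \<le> C - (K - 1) * ln (real n * z))" by metis
  show ?thesis
  proof (rule that[of \<delta> z0 "2 * exp C"])
    fix n :: nat and z :: real assume n: "3 \<le> n" and z: "z0 \<le> z"
    define t where "t = z * norming n"
    define y where "y = \<delta> * t"
    define \<theta> where "\<theta> = K * ln (real n * z) / t"
    have w: "0 < norming n" using n by (intro norming_pos) auto
    have z1: "1 \<le> z" using z * by linarith
    have nz: "1 < real n * z" using n z1 by (intro less_1_mult') auto
    have t0: "0 < t" using w z1 by (simp add: t_def)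
    have y0: "0 < y" using t0 * by (simp add: y_def)
    have \<theta>0: "0 < \<theta>" using t0 nz \<open>0 < K\<close> by (simp add: \<theta>_def)
    have e: "- \<theta> * t + real n * (\<theta> * V / y + \<theta>\<^sup>2 * V + exp (\<theta> * y) * \<theta> powr s * B)
          \<le> C - (K - 1) * ln (real n * z)"
      using ex[OF n z] by (simp only: Let_def t_def y_def \<theta>_def)
    have "prob {\<omega>\<in>space M. t < max_partial_sum X n \<omega>}
        \<le> real n * prob {\<omega>\<in>space M. y < \<bar>Y \<omega>\<bar>}
        + 2 * real n * exp (- \<theta> * t + real n * (\<theta> * V / y + \<theta>\<^sup>2 * V + exp (\<theta> * y) * \<theta> powr s * B))"
      unfolding V_def B_def using assms n \<theta>0 y0 by (intro max_partial_sum_tail_le) auto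
    also have "\<dots> \<le> real n * prob {\<omega>\<in>space M. y < \<bar>Y \<omega>\<bar>} + 2 * real n * exp (C - (K - 1) * ln (real n * z))"
      using e by (intro add_left_mono mult_left_mono) auto
    also have "exp (C - (K - 1) * ln (real n * z)) = exp C * (real n * z) powr (- (K - 1))"
    proof -
      have "exp (C - a * ln N) = exp C * N powr (- a)" if "0 < N" for a N :: real
        using that by (simp add: powr_def exp_diff exp_minus divide_inverse)
      then show ?thesis using nz by simp
    qed
    finally show "prob {\<omega>\<in>space M. z * norming n < max_partial_sum X n \<omega>}
      \<le> real n * prob {\<omega>\<in>space M. \<delta> * z * norming n < \<bar>Y \<omega>\<bar>} + 2 * exp C * real n * (real n * z) powr (- (K - 1))"
      by (simp add: t_def y_def ac_simps)
  qed (use * in auto)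
qed

text \<open>The order \<open>K = r + p + 2\<close> leaves summability in \<open>n\<close> and, with \<open>p = 1/q\<close> and \<open>z = x\<^sup>q\<close>, the
  integrable power \<open>x\<^bsup>-1-q\<^esup>\<close>.\<close>

lemma tail_series_le_tail_sum:
  assumes "integrable M Y" "expectation Y = 0" "integrable M (\<lambda>\<omega>. (Y \<omega>)\<^sup>2)"
    and "integrable M (\<lambda>\<omega>. \<bar>Y \<omega>\<bar> powr s)" "2 < s" and r: "1 < r" and p: "0 < p"
  obtains \<delta> z0 C where "0 < \<delta>" "\<delta> \<le> 1" "1 \<le> z0" "0 \<le> C"
    "\<And>z. z0 \<le> z \<Longrightarrow> tail_series M X r z \<le> tail_sum Y r (\<delta> * z) + ennreal (C * z powr (- (p + 1)))"
proof -
  define K where "K = r + p + 2"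
  have "0 < K" using r p by (simp add: K_def)
  from max_partial_sum_polynomial_tail[OF assms(1-5) this] obtain \<delta> z0 C where *: "0 < \<delta>" "\<delta> \<le> 1" "1 \<le> z0" "0 \<le> C"
    and tail: "\<And>n z. 3 \<le> n \<Longrightarrow> z0 \<le> z \<Longrightarrow> prob {\<omega>\<in>space M. z * norming n < max_partial_sum X n \<omega>}
      \<le> real n * prob {\<omega>\<in>space M. \<delta> * z * norming n < \<bar>Y \<omega>\<bar>} + C * real n * (real n * z) powr (- (K - 1))"
    by blast
  define h where "h n = C * real n powr (- 2)" for n :: nat
  have h: "summable h" unfolding h_def[abs_def] by (intro summable_mult) (simp add: summable_real_powr_iff)
  have h0: "0 \<le> h n" for n using * by (simp add: h_def)
  show ?thesis
  proof (rule that[of \<delta> z0 "\<Sum>n. h n"])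
    fix z assume z: "z0 \<le> z"
    then have z1: "1 \<le> z" using * by linarith
    let ?P = "\<lambda>n. prob {\<omega>\<in>space M. \<delta> * z * norming n < \<bar>Y \<omega>\<bar>}"
    have "tail_series M X r z \<le> (\<Sum>n. ennreal (real n powr (r - 1) * ?P n) * indicator {3..} n + ennreal (h n * z powr (- (p + 1))))"
      unfolding tail_series_eq
    proof (intro suminf_le summableI)
      fix n
      show "ennreal (real n powr (r - 2) * prob {\<omega>\<in>space M. z * norming n < max_partial_sum X n \<omega>}) * indicator {3..} n
        \<le> ennreal (real n powr (r - 1) * ?P n) * indicator {3..} n + ennreal (h n * z powr (- (p + 1)))"
      proof (cases "3 \<le> n")
        case True
        have n1: "real n powr (r - 2) * real n = real n powr (r - 1)"
          using True powr_add[of "real n" "r - 2" 1] by simp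
        have "real n powr (r - 2) * prob {\<omega>\<in>space M. z * norming n < max_partial_sum X n \<omega>}
          \<le> real n powr (r - 2) * (real n * ?P n + C * real n * (real n * z) powr (- (K - 1)))"
          using tail[OF True z] by (intro mult_left_mono) auto
        also have "\<dots> = (real n powr (r - 2) * real n) * ?P n + C * ((real n powr (r - 2) * real n) * (real n * z) powr (- (K - 1)))"
          by (simp add: algebra_simps)
        also have "\<dots> = real n powr (r - 1) * ?P n + C * (real n powr (r - 1 - (K - 1)) * z powr (- (K - 1)))"
          unfolding n1 using True z1 by (simp add: powr_mult powr_add[symmetric] mult.assoc[symmetric])
        also have "\<dots> \<le> real n powr (r - 1) * ?P n + C * (real n powr (- 2) * z powr (- (p + 1)))"
          using True z1 r p * by (intro add_left_mono mult_left_mono mult_mono powr_mono) (auto simp: K_def)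
        finally have "real n powr (r - 2) * prob {\<omega>\<in>space M. z * norming n < max_partial_sum X n \<omega>}
          \<le> real n powr (r - 1) * ?P n + h n * z powr (- (p + 1))" by (simp add: h_def mult.assoc)
        then show ?thesis using True h0[of n] by (simp add: ennreal_plus[symmetric] del: ennreal_plus)
      qed simp
    qed
    also have "\<dots> = tail_sum Y r (\<delta> * z) + (\<Sum>n. ennreal (h n * z powr (- (p + 1))))"
      unfolding tail_sum_def by (rule suminf_add[symmetric]) (auto intro: summableI)
    also have "(\<Sum>n. ennreal (h n * z powr (- (p + 1)))) = ennreal ((\<Sum>n. h n) * z powr (- (p + 1)))"
      using h h0 by (subst suminf_ennreal2) (auto intro: summable_mult2 simp: suminf_mult2)
    finally show "tail_series M X r z \<le> tail_sum Y r (\<delta> * z) + ennreal ((\<Sum>n. h n) * z powr (- (p + 1)))" .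
  qed (use * h h0 in \<open>auto intro: suminf_nonneg\<close>)
qed

text \<open>The lower limit of integration is chosen such that \<open>x\<^sup>q\<close> always reaches the range where the exponential
  bound is available; that it is at least \<open>1\<close> is what the estimates of the tail sum ask for.\<close>

lemma tail_integral_finite_of_tail_sum:
  assumes "integrable M Y" "expectation Y = 0" "integrable M (\<lambda>\<omega>. (Y \<omega>)\<^sup>2)"
    and "integrable M (\<lambda>\<omega>. \<bar>Y \<omega>\<bar> powr s)" "2 < s" and r: "1 < r" and q: "0 < q"
    and fin: "\<And>\<delta> \<epsilon>. 0 < \<delta> \<Longrightarrow> \<delta> \<le> 1 \<Longrightarrow> 1 \<le> \<epsilon> \<Longrightarrow> (\<integral>\<^sup>+x\<in>{\<epsilon>..}. tail_sum Y r (\<delta> * x powr q) \<partial>lborel) < \<infinity>"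
  shows "\<exists>\<epsilon>>0. (\<integral>\<^sup>+x\<in>{\<epsilon>..}. tail_series M X r (x powr q) \<partial>lborel) < \<infinity>"
proof -
  from tail_series_le_tail_sum[OF assms(1-6), of "1 / q"] q
  obtain \<delta> z0 C where *: "0 < \<delta>" "\<delta> \<le> 1" "1 \<le> z0" "0 \<le> C"
    and le: "\<And>z. z0 \<le> z \<Longrightarrow> tail_series M X r z \<le> tail_sum Y r (\<delta> * z) + ennreal (C * z powr (- (1 / q + 1)))"
    by (metis zero_less_divide_1_iff)
  define \<epsilon> where "\<epsilon> = z0 powr (1 / q)"
  have \<epsilon>: "1 \<le> \<epsilon>" using * q by (simp add: \<epsilon>_def ge_one_powr_ge_zero)
  have "(\<integral>\<^sup>+x\<in>{\<epsilon>..}. tail_series M X r (x powr q) \<partial>lborel)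
    \<le> (\<integral>\<^sup>+x. tail_sum Y r (\<delta> * x powr q) * indicator {\<epsilon>..} x + ennreal C * (ennreal (x powr (- 1 - q)) * indicator {\<epsilon>..} x) \<partial>lborel)"
  proof (rule nn_integral_mono)
    fix x :: real
    show "tail_series M X r (x powr q) * indicator {\<epsilon>..} x
      \<le> tail_sum Y r (\<delta> * x powr q) * indicator {\<epsilon>..} x + ennreal C * (ennreal (x powr (- 1 - q)) * indicator {\<epsilon>..} x)"
    proof (cases "\<epsilon> \<le> x")
      case True
      have "z0 = \<epsilon> powr q" using * q by (simp add: \<epsilon>_def powr_powr)
      also have "\<dots> \<le> x powr q" using True \<epsilon> q by (intro powr_mono2) auto
      finally have "tail_series M X r (x powr q) \<le> tail_sum Y r (\<delta> * x powr q) + ennreal (C * (x powr q) powr (- (1 / q + 1)))"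
        by (rule le)
      also have "(x powr q) powr (- (1 / q + 1)) = x powr (- 1 - q)"
      proof -
        have "q * (- (1 / q + 1)) = - 1 - q" using q by (simp add: field_simps)
        then show ?thesis by (simp only: powr_powr)
      qed
      finally show ?thesis using True * by (simp add: ennreal_mult)
    qed simp
  qed
  also have "\<dots> = (\<integral>\<^sup>+x\<in>{\<epsilon>..}. tail_sum Y r (\<delta> * x powr q) \<partial>lborel) + ennreal C * (\<integral>\<^sup>+x\<in>{\<epsilon>..}. ennreal (x powr (- 1 - q)) \<partial>lborel)"
    by (subst nn_integral_add) (auto simp: nn_integral_cmult)
  also have "\<dots> < \<infinity>"
    using fin[OF *(1,2) \<epsilon>] nn_integral_powr_to_inf[of "- 1 - q" \<epsilon>] q \<epsilon> by (simp add: ennreal_mult_less_top)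
  finally show ?thesis using \<epsilon> by (intro exI[of _ \<epsilon>]) auto
qed

lemma moments_imp_tail_integral:
  assumes r: "1 < r" and q: "0 < q"
    and high: "q \<le> 1 / (2 * r) \<Longrightarrow> (\<integral>\<^sup>+\<omega>. ennreal (\<bar>Y \<omega>\<bar> powr (1 / q)) \<partial>M) < \<infinity>"
    and low: "1 / (2 * r) < q \<Longrightarrow> (\<integral>\<^sup>+\<omega>. ennreal (\<bar>Y \<omega>\<bar> powr (2 * r) * log_plus \<bar>Y \<omega>\<bar> powr (- r)) \<partial>M) < \<infinity>"
    and mean: "integrable M Y" "expectation Y = 0"
  shows "\<exists>\<epsilon>>0. (\<integral>\<^sup>+x\<in>{\<epsilon>..}. tail_series M X r (x powr q) \<partial>lborel) < \<infinity>"
proof -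
  have s: "integrable M (\<lambda>\<omega>. \<bar>Y \<omega>\<bar> powr (1 + r))"
  proof (cases "q \<le> 1 / (2 * r)")
    case True
    have "integrable M (\<lambda>\<omega>. \<bar>Y \<omega>\<bar> powr (1 / q))" using high[OF True] by (intro integrableI_nonneg) auto
    moreover have "1 + r \<le> 1 / q"
    proof -
      have "2 * r \<le> 1 / q" using True r q by (simp add: field_simps)
      then show ?thesis using r by linarith
    qed
    ultimately show ?thesis using r by (auto intro: integrable_abs_powr_mono[OF Y_measurable, of "1 / q"])
  next
    case False
    then show ?thesis using low r by (intro integrable_of_log_moment) auto
  qed
  have "integrable M (\<lambda>\<omega>. \<bar>Y \<omega>\<bar> powr 2)" by (rule integrable_abs_powr_mono[OF Y_measurable s]) (use r in auto)
  then have sq: "integrable M (\<lambda>\<omega>. (Y \<omega>)\<^sup>2)" by simp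
  show ?thesis
  proof (rule tail_integral_finite_of_tail_sum[OF mean sq s _ r q])
    fix \<delta> \<epsilon> :: real assume *: "0 < \<delta>" "\<delta> \<le> 1" "1 \<le> \<epsilon>"
    show "(\<integral>\<^sup>+x\<in>{\<epsilon>..}. tail_sum Y r (\<delta> * x powr q) \<partial>lborel) < \<infinity>"
    proof (cases "q \<le> 1 / (2 * r)")
      case True
      then show ?thesis
        using * by (intro tail_sum_integral_high_power[OF Y_measurable r q True high[OF True]]) auto
    next
      case False
      then have F: "1 / (2 * r) < q" by simp
      show ?thesis
        by (rule tail_sum_integral_low_power[OF Y_measurable r q F low[OF F] *])
    qed
  qed (use r in auto)
qed

section \<open>From the tail series to moments\<close>

text \<open>The integrand is decreasing, so on \<open>[\<epsilon>, 2 \<epsilon>]\<close> it is at least its value at the right end.\<close>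

lemma tail_series_finite_if_integral_finite:
  assumes "(\<integral>\<^sup>+x\<in>{\<epsilon>..}. tail_series M X r (x powr q) \<partial>lborel) < \<infinity>" "0 < \<epsilon>" "0 < q"
  shows "tail_series M X r ((2 * \<epsilon>) powr q) < \<infinity>"
proof -
  have "tail_series M X r ((2 * \<epsilon>) powr q) * ennreal \<epsilon> = (\<integral>\<^sup>+x. tail_series M X r ((2 * \<epsilon>) powr q) * indicator {\<epsilon>..2 * \<epsilon>} x \<partial>lborel)"
    using assms by (simp add: nn_integral_cmult_indicator)
  also have "\<dots> \<le> (\<integral>\<^sup>+x\<in>{\<epsilon>..}. tail_series M X r (x powr q) \<partial>lborel)"
    using assms by (intro nn_integral_mono) (auto simp: indicator_def intro!: tail_series_antimono powr_mono2)
  also have "\<dots> < \<infinity>" by fact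
  finally show ?thesis using assms by (auto simp: ennreal_mult_less_top)
qed

text \<open>For \<open>m \<le> n \<le> 2 m\<close> one has \<open>w\<^sub>n \<le> 2 w\<^sub>m\<close>, so the event for \<open>m\<close> at level \<open>2 z\<^sub>0\<close> is contained in the
  event for \<open>n\<close> at level \<open>z\<^sub>0\<close>.  As \<open>r > 1\<close>, each weight \<open>n\<^bsup>r-2\<^esup>\<close> is at least \<open>1 / (2 m)\<close>, and the block has
  more than \<open>m\<close> terms: half of the probability for \<open>m\<close> is at most a block of a convergent series.\<close>

lemma tail_prob_small:
  assumes z0: "0 < z0" and r: "1 < r" and fin: "tail_series M X r z0 < \<infinity>"
  obtains m0 where "3 \<le> m0"
    "\<And>m. m0 \<le> m \<Longrightarrow> prob {\<omega>\<in>space M. 2 * z0 * norming m < max_partial_sum X m \<omega>} \<le> 1 / 4"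
proof -
  define a where "a n = prob {\<omega>\<in>space M. z0 * norming n < max_partial_sum X n \<omega>}" for n
  define b where "b m = prob {\<omega>\<in>space M. 2 * z0 * norming m < max_partial_sum X m \<omega>}" for m
  define g where "g n = (if 3 \<le> n then real n powr (r - 2) * a n else 0)" for n
  have g0: "0 \<le> g n" for n by (simp add: g_def a_def)
  have "tail_series M X r z0 = (\<Sum>n. ennreal (g n))"
    unfolding tail_series_eq by (intro arg_cong[where f = suminf] ext) (auto simp: g_def a_def)
  then have "summable g" using fin g0 by (intro summable_suminf_not_top) auto
  then obtain N where N: "\<And>m n. N \<le> m \<Longrightarrow> norm (sum g {m..<n}) < 1 / 8"
    unfolding summable_Cauchy by (meson zero_less_divide_1_iff zero_less_numeral)
  show ?thesis
  proof (rule that[of "max N 3"])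
    fix m assume m: "max N 3 \<le> m"
    have ab: "b m \<le> a n" if n: "n \<in> {m..2 * m}" for n
    proof -
      have "norming n \<le> norming (2 * m)" using n m by (intro norming_mono) auto
      also have "\<dots> \<le> 2 * norming m" using m by (intro norming_doubled) auto
      finally have "z0 * norming n \<le> 2 * z0 * norming m" using z0 by simp
      moreover have "max_partial_sum X m \<omega> \<le> max_partial_sum X n \<omega>" for \<omega>
        using n m by (intro max_partial_sum_mono) auto
      moreover have "1 \<le> n" using n m by auto
      ultimately show ?thesis unfolding a_def b_def
        by (intro finite_measure_mono) (auto intro: le_less_trans less_le_trans)
    qed
    have "b m / 2 \<le> real (m + 1) * (1 / real (2 * m) * b m)"
      using m by (simp add: b_def field_simps)
    also have "\<dots> = (\<Sum>n\<in>{m..2 * m}. 1 / real (2 * m) * b m)" by simp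
    also have "\<dots> \<le> (\<Sum>n\<in>{m..2 * m}. g n)"
    proof (rule sum_mono)
      fix n assume n: "n \<in> {m..2 * m}"
      have "1 / real (2 * m) \<le> 1 / real n" using n m by (intro divide_left_mono) auto
      also have "\<dots> = real n powr (- 1)" using n m by (simp add: powr_minus field_simps)
      also have "\<dots> \<le> real n powr (r - 2)" using n m r by (intro powr_mono) auto
      finally have "1 / real (2 * m) * b m \<le> real n powr (r - 2) * a n"
        using ab[OF n] by (intro mult_mono) (auto simp: b_def)
      then show "1 / real (2 * m) * b m \<le> g n" using n m by (simp add: g_def)
    qed
    also have "\<dots> \<le> 1 / 8" using N[of m "Suc (2 * m)"] m by (simp add: atLeastLessThanSuc_atLeastAtMost)
    finally show "prob {\<omega>\<in>space M. 2 * z0 * norming m < max_partial_sum X m \<omega>} \<le> 1 / 4" by (simp add: b_def)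
  qed simp
qed

text \<open>From \<open>m0\<close> on, the second moment method bounds \<open>n P (\<bar>X\<bar> > 4 z\<^sub>0 w\<^sub>n)\<close> by the terms of the tail
  series, and the lower count recovers the moment from the weighted sum of the indicators.\<close>

lemma log_moment_finite:
  assumes z0: "0 < z0" and r: "1 < r" and fin: "tail_series M X r z0 < \<infinity>"
  shows "(\<integral>\<^sup>+\<omega>. ennreal (\<bar>Y \<omega>\<bar> powr (2 * r) * log_plus \<bar>Y \<omega>\<bar> powr (- r)) \<partial>M) < \<infinity>"
proof -
  obtain m0 where m0: "3 \<le> m0"
    and small: "\<And>m. m0 \<le> m \<Longrightarrow> prob {\<omega>\<in>space M. 2 * z0 * norming m < max_partial_sum X m \<omega>} \<le> 1 / 4"
    using tail_prob_small[OF assms] by metis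
  define c where "c = 4 * z0"
  define G where "G y = (\<Sum>n. ennreal (real n powr (r - 1)) * indicator {n. m0 \<le> n \<and> c * norming n < \<bar>y\<bar>} n)" for y :: real
  have G_int: "(\<integral>\<^sup>+\<omega>. G (Y \<omega>) \<partial>M) \<le> 4 * tail_series M X r z0"
  proof -
    have "(\<integral>\<^sup>+\<omega>. G (Y \<omega>) \<partial>M) = (\<Sum>n. \<integral>\<^sup>+\<omega>. ennreal (real n powr (r - 1)) * indicator {n. m0 \<le> n \<and> c * norming n < \<bar>Y \<omega>\<bar>} n \<partial>M)"
      unfolding G_def by (rule nn_integral_suminf) (simp add: indicator_def, measurable)
    also have "\<dots> \<le> (\<Sum>n. 4 * (ennreal (real n powr (r - 2) * prob {\<omega>\<in>space M. z0 * norming n < max_partial_sum X n \<omega>}) * indicator {3..} n))"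
    proof (intro suminf_le summableI)
      fix n
      let ?A = "{\<omega>\<in>space M. c * norming n < \<bar>Y \<omega>\<bar>}"
      have "(\<integral>\<^sup>+\<omega>. ennreal (real n powr (r - 1)) * indicator {n. m0 \<le> n \<and> c * norming n < \<bar>Y \<omega>\<bar>} n \<partial>M)
        = (\<integral>\<^sup>+\<omega>. (ennreal (real n powr (r - 1)) * indicator {m0..} n) * indicator ?A \<omega> \<partial>M)"
        by (intro nn_integral_cong) (auto simp: indicator_def)
      also have "\<dots> = (ennreal (real n powr (r - 1)) * indicator {m0..} n) * emeasure M ?A"
        by (intro nn_integral_cmult_indicator) measurable
      also have "\<dots> \<le> 4 * (ennreal (real n powr (r - 2) * prob {\<omega>\<in>space M. z0 * norming n < max_partial_sum X n \<omega>}) * indicator {3..} n)"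
      proof (cases "m0 \<le> n")
        case True
        then have n: "3 \<le> n" using m0 by simp
        have n1: "real n powr (r - 1) = real n powr (r - 2) * real n"
          using n powr_add[of "real n" "r - 2" 1] by simp
        let ?b = "prob {\<omega>\<in>space M. 2 * z0 * norming n < max_partial_sum X n \<omega>}"
        have "?b \<le> 1 / 2" using small[OF True] by simp
        then have "real n * prob {\<omega>\<in>space M. 2 * (2 * z0 * norming n) < \<bar>Y \<omega>\<bar>} \<le> 4 * ?b"
          using n by (intro abs_tail_le_max_partial_sum) auto
        also have "?b \<le> prob {\<omega>\<in>space M. z0 * norming n < max_partial_sum X n \<omega>}"
          using n z0 by (intro tail_prob_antimono) auto
        finally have nP: "real n * prob ?A \<le> 4 * prob {\<omega>\<in>space M. z0 * norming n < max_partial_sum X n \<omega>}"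
          by (simp add: c_def mult.assoc)
        have "real n powr (r - 1) * prob ?A \<le> 4 * (real n powr (r - 2) * prob {\<omega>\<in>space M. z0 * norming n < max_partial_sum X n \<omega>})"
          unfolding n1 using mult_left_mono[OF nP, of "real n powr (r - 2)"] by (simp add: mult.assoc mult.left_commute)
        then have "ennreal (real n powr (r - 1) * prob ?A) \<le> ennreal (4 * (real n powr (r - 2) * prob {\<omega>\<in>space M. z0 * norming n < max_partial_sum X n \<omega>}))"
          by (rule ennreal_leI)
        then show ?thesis using True n by (simp add: emeasure_eq_measure ennreal_mult)
      qed simp
      finally show "(\<integral>\<^sup>+\<omega>. ennreal (real n powr (r - 1)) * indicator {n. m0 \<le> n \<and> c * norming n < \<bar>Y \<omega>\<bar>} n \<partial>M)
        \<le> 4 * (ennreal (real n powr (r - 2) * prob {\<omega>\<in>space M. z0 * norming n < max_partial_sum X n \<omega>}) * indicator {3..} n)" .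
    qed
    finally show ?thesis by (simp add: tail_series_eq)
  qed
  have Gm: "(\<lambda>\<omega>. G (Y \<omega>)) \<in> borel_measurable M" unfolding G_def by (simp add: indicator_def, measurable)
  have "0 < c" using z0 by (simp add: c_def)
  from sum_powr_norming_ge[OF r this, of m0] obtain C1 C2 where C: "0 \<le> C1" "0 \<le> C2"
    and le: "\<And>y. ennreal ((y\<^sup>2 / log_plus \<bar>y\<bar>) powr r) \<le> ennreal C1 + ennreal C2 * G y"
    unfolding G_def by blast
  have "(\<integral>\<^sup>+\<omega>. ennreal (\<bar>Y \<omega>\<bar> powr (2 * r) * log_plus \<bar>Y \<omega>\<bar> powr (- r)) \<partial>M) \<le> (\<integral>\<^sup>+\<omega>. ennreal C1 + ennreal C2 * G (Y \<omega>) \<partial>M)"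
    unfolding log_moment_eq by (intro nn_integral_mono le)
  also have "\<dots> = ennreal C1 + ennreal C2 * (\<integral>\<^sup>+\<omega>. G (Y \<omega>) \<partial>M)"
    using Gm by (simp add: nn_integral_add nn_integral_cmult emeasure_space_1)
  also have "\<dots> < \<infinity>"
    using le_less_trans[OF G_int, of \<infinity>] fin by (simp add: ennreal_mult_less_top)
  finally show ?thesis .
qed

text \<open>If \<open>\<mu> \<noteq> 0\<close>, Chebyshev puts \<open>\<bar>S\<^sub>m\<bar>\<close> above \<open>m \<bar>\<mu>\<bar> / 2\<close>, which for large \<open>m\<close> is above \<open>2 z\<^sub>0 w\<^sub>m\<close>, with probability
  at least \<open>3/4\<close>.  By the previous estimates this probability is at most \<open>1/4\<close>.\<close>

lemma mean_zero_if_tail_series_finite: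
  assumes z0: "0 < z0" and r: "1 < r" and fin: "tail_series M X r z0 < \<infinity>"
    and sq: "integrable M (\<lambda>\<omega>. (Y \<omega>)\<^sup>2)"
  shows "expectation Y = 0"
proof (rule ccontr)
  define \<mu> where "\<mu> = expectation Y"
  assume "expectation Y \<noteq> 0"
  then have \<mu>: "\<mu> \<noteq> 0" by (simp add: \<mu>_def)
  obtain m0 where m0: "3 \<le> m0"
    and small: "\<And>m. m0 \<le> m \<Longrightarrow> prob {\<omega>\<in>space M. 2 * z0 * norming m < max_partial_sum X m \<omega>} \<le> 1 / 4"
    using tail_prob_small[OF z0 r fin] by metis
  have Y: "integrable M Y" by (rule square_integrable_imp_integrable[OF Y_measurable sq])
  define f where "f x = x - \<mu>" for x :: real
  have [measurable]: "f \<in> borel_measurable borel" unfolding f_def by measurable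
  have f: "mono f" by (auto simp: mono_def f_def)
  have fY2: "integrable M (\<lambda>\<omega>. (f (Y \<omega>))\<^sup>2)"
    unfolding f_def power2_diff using sq Y by simp
  have fY: "expectation (\<lambda>\<omega>. f (Y \<omega>)) = 0" unfolding f_def using Y by (simp add: prob_space \<mu>_def)
  define V where "V = expectation (\<lambda>\<omega>. (f (Y \<omega>))\<^sup>2)"
  have bound: "prob {\<omega>\<in>space M. \<bar>partial_sum X m \<omega> - real m * \<mu>\<bar> \<ge> real m * \<bar>\<mu>\<bar> / 2} \<le> 4 * V / (real m * \<mu>\<^sup>2)" if m: "1 \<le> m" for m
  proof -
    define T where "T \<omega> = (\<Sum>i\<in>{1..m}. f (X i \<omega>))" for \<omega>
    have T: "T \<omega> = partial_sum X m \<omega> - real m * \<mu>" for \<omega>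
      by (simp add: T_def f_def sum_subtractf partial_sum_def)
    have [measurable]: "T \<in> borel_measurable M" unfolding T[abs_def] by measurable
    have sqX: "integrable M (\<lambda>\<omega>. (f (X i \<omega>))\<^sup>2)" "expectation (\<lambda>\<omega>. (f (X i \<omega>))\<^sup>2) = V"
      "expectation (\<lambda>\<omega>. f (X i \<omega>)) = 0" if "i \<in> {1..m}" for i
      using that fY2 fY integrable_X_iff[of "\<lambda>x. (f x)\<^sup>2" i] expectation_X[of "\<lambda>x. (f x)\<^sup>2" i] expectation_X[of f i]
      by (auto simp: V_def)
    have T2: "integrable M (\<lambda>\<omega>. (T \<omega>)\<^sup>2)" "expectation (\<lambda>\<omega>. (T \<omega>)\<^sup>2) \<le> real m * V"
      using neg_assoc_second_moment_sum_le[OF na X_measurable f, of "{1..m}"] sqX unfolding T_def by auto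
    have "prob {\<omega>\<in>space M. \<bar>T \<omega>\<bar> \<ge> real m * \<bar>\<mu>\<bar> / 2} \<le> expectation (\<lambda>\<omega>. (T \<omega>)\<^sup>2) / (real m * \<bar>\<mu>\<bar> / 2)\<^sup>2"
      using T2 m \<mu> by (intro second_moment_method) auto
    also have "\<dots> \<le> (real m * V) / (real m * \<bar>\<mu>\<bar> / 2)\<^sup>2" using T2 by (intro divide_right_mono) auto
    also have "\<dots> = 4 * V / (real m * \<mu>\<^sup>2)" using m by (simp add: power2_eq_square field_simps)
    finally show ?thesis by (simp add: T)
  qed
  have "(\<lambda>m. norming m / real m) \<longlonglongrightarrow> 0" unfolding norming_def by real_asymp
  then have "\<forall>\<^sub>F m in sequentially. norming m / real m < \<bar>\<mu>\<bar> / (4 * z0)"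
    by (rule order_tendstoD) (use \<mu> z0 in auto)
  moreover have "(\<lambda>m. (4 * V / \<mu>\<^sup>2) * (1 / real m)) \<longlonglongrightarrow> (4 * V / \<mu>\<^sup>2) * 0"
    by (intro tendsto_intros lim_1_over_n)
  then have "\<forall>\<^sub>F m in sequentially. (4 * V / \<mu>\<^sup>2) * (1 / real m) < 1 / 4"
    by (rule order_tendstoD) auto
  ultimately have "\<forall>\<^sub>F m in sequentially. m0 \<le> m \<and> norming m / real m < \<bar>\<mu>\<bar> / (4 * z0) \<and> (4 * V / \<mu>\<^sup>2) * (1 / real m) < 1 / 4"
    using eventually_ge_at_top[of m0] by eventually_elim auto
  then obtain m where m: "m0 \<le> m" "norming m / real m < \<bar>\<mu>\<bar> / (4 * z0)" "(4 * V / \<mu>\<^sup>2) * (1 / real m) < 1 / 4"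
    by (auto dest: eventually_happens)
  have m1: "1 \<le> m" using m m0 by simp
  have w: "2 * z0 * norming m < real m * \<bar>\<mu>\<bar> / 2" using m(2) m1 z0 by (simp add: field_simps)
  let ?F = "{\<omega>\<in>space M. \<bar>partial_sum X m \<omega> - real m * \<mu>\<bar> \<ge> real m * \<bar>\<mu>\<bar> / 2}"
  let ?D = "{\<omega>\<in>space M. 2 * z0 * norming m < max_partial_sum X m \<omega>}"
  have [measurable]: "max_partial_sum X m \<in> borel_measurable M" using m1 by measurable
  have "space M \<subseteq> ?F \<union> ?D"
  proof
    fix \<omega> assume \<omega>: "\<omega> \<in> space M"
    show "\<omega> \<in> ?F \<union> ?D"
    proof (cases "\<bar>partial_sum X m \<omega> - real m * \<mu>\<bar> \<ge> real m * \<bar>\<mu>\<bar> / 2")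
      case False
      have "\<bar>real m * \<mu>\<bar> = real m * \<bar>\<mu>\<bar>" by (simp add: abs_mult)
      then have "real m * \<bar>\<mu>\<bar> / 2 < \<bar>partial_sum X m \<omega>\<bar>" using False by linarith
      also have "\<dots> \<le> max_partial_sum X m \<omega>" using m1 by (intro abs_le_max_partial_sum) auto
      finally show ?thesis using w \<omega> by auto
    qed (use \<omega> in auto)
  qed
  then have "prob (space M) \<le> prob (?F \<union> ?D)" by (intro finite_measure_mono) auto
  also have "\<dots> \<le> prob ?F + prob ?D" by (intro measure_Un_le) auto
  also have "\<dots> \<le> 1 / 4 + 1 / 4"
  proof (rule add_mono)
    have "4 * V / (real m * \<mu>\<^sup>2) = (4 * V / \<mu>\<^sup>2) * (1 / real m)" by (simp add: mult.commute)
    then show "prob ?F \<le> 1 / 4" using bound[OF m1] m(3) by linarith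
  qed (rule small[OF m(1)])
  finally show False by (simp add: prob_space)
qed

text \<open>The term \<open>n = 3\<close> of the tail series already dominates the tail of \<open>X\<^sub>1 = S\<^sub>1\<close>.\<close>

lemma high_moment_finite:
  assumes r: "1 < r" and q: "0 < q" and \<epsilon>: "0 < \<epsilon>"
    and fin: "(\<integral>\<^sup>+x\<in>{\<epsilon>..}. tail_series M X r (x powr q) \<partial>lborel) < \<infinity>"
  shows "(\<integral>\<^sup>+\<omega>. ennreal (\<bar>Y \<omega>\<bar> powr (1 / q)) \<partial>M) < \<infinity>"
proof -
  define w where "w = norming 3"
  have w: "0 < w" by (simp add: w_def norming_pos)
  have pm [measurable]: "(\<lambda>x. prob {\<omega>\<in>space M. x powr q * w < \<bar>Y \<omega>\<bar>}) \<in> borel_measurable borel"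
    using w by (intro measurable_compose[OF _ prob_tail_measurable, of "\<lambda>x. x powr q"]) auto
  have le: "ennreal (3 powr (r - 2)) * ennreal (prob {\<omega>\<in>space M. x powr q * w < \<bar>Y \<omega>\<bar>}) \<le> tail_series M X r (x powr q)" for x
  proof -
    have "prob {\<omega>\<in>space M. x powr q * w < \<bar>Y \<omega>\<bar>} = prob {\<omega>\<in>space M. x powr q * w < \<bar>X 1 \<omega>\<bar>}"
      using prob_X[of "{y. x powr q * w < \<bar>y\<bar>}" 1] by simp
    also have "\<dots> \<le> prob {\<omega>\<in>space M. x powr q * norming 3 < max_partial_sum X 3 \<omega>}"
      using abs_le_max_partial_sum(2)[of 1 3 X]
      by (intro finite_measure_mono) (auto simp: w_def partial_sum_def intro: less_le_trans)
    finally have "ennreal (3 powr (r - 2) * prob {\<omega>\<in>space M. x powr q * w < \<bar>Y \<omega>\<bar>})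
      \<le> ennreal (real 3 powr (r - 2) * prob {\<omega>\<in>space M. x powr q * norming 3 < max_partial_sum X 3 \<omega>}) * indicator {3..} (3 :: nat)"
      by (auto intro!: ennreal_leI mult_left_mono)
    also have "\<dots> = (\<Sum>n\<in>{3}. ennreal (real n powr (r - 2) * prob {\<omega>\<in>space M. x powr q * norming n < max_partial_sum X n \<omega>}) * indicator {3..} n)"
      by simp
    also have "\<dots> \<le> tail_series M X r (x powr q)" unfolding tail_series_eq by (intro sum_le_suminf) auto
    finally show ?thesis by (simp add: ennreal_mult)
  qed
  define W where "W \<omega> = (\<bar>Y \<omega>\<bar> / w) powr (1 / q)" for \<omega>
  have [measurable]: "W \<in> borel_measurable M" unfolding W_def by measurable
  have "ennreal (3 powr (r - 2)) * (\<integral>\<^sup>+\<omega>. ennreal (max 0 (W \<omega> - \<epsilon>)) \<partial>M)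
    = ennreal (3 powr (r - 2)) * (\<integral>\<^sup>+x\<in>{\<epsilon>..}. ennreal (prob {\<omega>\<in>space M. x powr q * w < \<bar>Y \<omega>\<bar>}) \<partial>lborel)"
    unfolding W_def using w q \<epsilon> by (subst nn_integral_power_tail) auto
  also have "\<dots> = (\<integral>\<^sup>+x. ennreal (3 powr (r - 2)) * (ennreal (prob {\<omega>\<in>space M. x powr q * w < \<bar>Y \<omega>\<bar>}) * indicator {\<epsilon>..} x) \<partial>lborel)"
    by (intro nn_integral_cmult[symmetric]) measurable
  also have "\<dots> \<le> (\<integral>\<^sup>+x\<in>{\<epsilon>..}. tail_series M X r (x powr q) \<partial>lborel)"
    using le by (intro nn_integral_mono) (auto simp: indicator_def)
  also have "\<dots> < \<infinity>" by (rule fin)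
  finally have excess: "(\<integral>\<^sup>+\<omega>. ennreal (max 0 (W \<omega> - \<epsilon>)) \<partial>M) < \<infinity>"
    by (auto simp: ennreal_mult_less_top)
  have "(\<integral>\<^sup>+\<omega>. ennreal (\<bar>Y \<omega>\<bar> powr (1 / q)) \<partial>M) \<le> (\<integral>\<^sup>+\<omega>. ennreal (w powr (1 / q)) * (ennreal \<epsilon> + ennreal (max 0 (W \<omega> - \<epsilon>))) \<partial>M)"
  proof (rule nn_integral_mono)
    fix \<omega>
    have "\<bar>Y \<omega>\<bar> powr (1 / q) = w powr (1 / q) * W \<omega>" using w by (simp add: W_def powr_divide)
    also have "\<dots> \<le> w powr (1 / q) * (\<epsilon> + max 0 (W \<omega> - \<epsilon>))" by (intro mult_left_mono) auto
    finally have "ennreal (\<bar>Y \<omega>\<bar> powr (1 / q)) \<le> ennreal (w powr (1 / q) * (\<epsilon> + max 0 (W \<omega> - \<epsilon>)))"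
      by (rule ennreal_leI)
    also have "\<dots> = ennreal (w powr (1 / q)) * (ennreal \<epsilon> + ennreal (max 0 (W \<omega> - \<epsilon>)))"
    proof -
      have "ennreal (\<epsilon> + max 0 (W \<omega> - \<epsilon>)) = ennreal \<epsilon> + ennreal (max 0 (W \<omega> - \<epsilon>))"
        by (rule ennreal_plus) (use \<epsilon> in auto)
      then show ?thesis by (simp only: ennreal_mult'[OF powr_ge_zero])
    qed
    finally show "ennreal (\<bar>Y \<omega>\<bar> powr (1 / q)) \<le> ennreal (w powr (1 / q)) * (ennreal \<epsilon> + ennreal (max 0 (W \<omega> - \<epsilon>)))" .
  qed
  also have "\<dots> = ennreal (w powr (1 / q)) * (ennreal \<epsilon> + (\<integral>\<^sup>+\<omega>. ennreal (max 0 (W \<omega> - \<epsilon>)) \<partial>M))"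
    by (simp add: nn_integral_cmult nn_integral_add emeasure_space_1)
  also have "\<dots> < \<infinity>" using excess by (simp add: ennreal_mult_less_top)
  finally show ?thesis .
qed

lemma tail_integral_imp_moments:
  assumes r: "1 < r" and q: "0 < q" and \<epsilon>: "0 < \<epsilon>"
    and fin: "(\<integral>\<^sup>+x\<in>{\<epsilon>..}. tail_series M X r (x powr q) \<partial>lborel) < \<infinity>"
  shows "(\<integral>\<^sup>+\<omega>. ennreal (\<bar>Y \<omega>\<bar> powr (1 / q)) \<partial>M) < \<infinity>"
    and "(\<integral>\<^sup>+\<omega>. ennreal (\<bar>Y \<omega>\<bar> powr (2 * r) * log_plus \<bar>Y \<omega>\<bar> powr (- r)) \<partial>M) < \<infinity>"
    and "integrable M Y" and "expectation Y = 0"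
proof -
  have ts: "tail_series M X r ((2 * \<epsilon>) powr q) < \<infinity>"
    by (rule tail_series_finite_if_integral_finite[OF fin \<epsilon> q])
  have z0: "0 < (2 * \<epsilon>) powr q" using \<epsilon> by simp
  show lm: "(\<integral>\<^sup>+\<omega>. ennreal (\<bar>Y \<omega>\<bar> powr (2 * r) * log_plus \<bar>Y \<omega>\<bar> powr (- r)) \<partial>M) < \<infinity>"
    by (rule log_moment_finite[OF z0 r ts])
  have "integrable M (\<lambda>\<omega>. \<bar>Y \<omega>\<bar> powr 2)"
    by (rule integrable_abs_powr_mono[OF Y_measurable integrable_of_log_moment[OF Y_measurable r lm]]) (use r in auto)
  then have sq: "integrable M (\<lambda>\<omega>. (Y \<omega>)\<^sup>2)" by simp
  show "integrable M Y" by (rule square_integrable_imp_integrable[OF Y_measurable sq])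
  show "expectation Y = 0" by (rule mean_zero_if_tail_series_finite[OF z0 r ts sq])
  show "(\<integral>\<^sup>+\<omega>. ennreal (\<bar>Y \<omega>\<bar> powr (1 / q)) \<partial>M) < \<infinity>" by (rule high_moment_finite[OF assms])
qed

end

section \<open>The equivalence\<close>

theorem theorem2p2:
  fixes M :: "'a measure" and X :: "nat \<Rightarrow> 'a \<Rightarrow> real" and Y :: "'a \<Rightarrow> real"
    and r q :: real
  assumes "prob_space M"
    and "\<And>n. n \<ge> 1 \<Longrightarrow> X n \<in> borel_measurable M"
    and "Y \<in> borel_measurable M"
    and "\<And>n. n \<ge> 1 \<Longrightarrow> distr M borel (X n) = distr M borel Y"
    and "neg_assoc M {1..} X"
    and "r > 1" and "q > 0"
  defines "cond_i \<equiv> \<exists>\<epsilon>>0.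
      (\<Sum>\<^sub>\<infinity>n\<in>{3..}. ennreal (real n powr (r - 2 - 1 / (2 * q)) * ln (real n) powr (- 1 / (2 * q))) *
         (\<integral>\<^sup>+\<omega>. ennreal (max 0
            ((MAX k\<in>{1..n}. \<bar>partial_sum X k \<omega>\<bar> powr (1 / q))
              - \<epsilon> * (real n * ln (real n)) powr (1 / (2 * q)))) \<partial>M)) < \<infinity>"
    and "cond_ii \<equiv> \<exists>\<epsilon>>0. (\<integral>\<^sup>+x\<in>{\<epsilon>..}. tail_series M X r (x powr q) \<partial>lborel) < \<infinity>"
    and "cond_iii \<equiv>
      (q \<le> 1 / (2 * r) \<longrightarrow> (\<integral>\<^sup>+\<omega>. ennreal (\<bar>Y \<omega>\<bar> powr (1 / q)) \<partial>M) < \<infinity>) \<and>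
      (q > 1 / (2 * r) \<longrightarrow>
         (\<integral>\<^sup>+\<omega>. ennreal (\<bar>Y \<omega>\<bar> powr (2 * r) * log_plus \<bar>Y \<omega>\<bar> powr (- r)) \<partial>M) < \<infinity>) \<and>
      integrable M Y \<and> (\<integral>\<omega>. Y \<omega> \<partial>M) = 0"
  shows "(cond_i \<longleftrightarrow> cond_ii) \<and> (cond_ii \<longleftrightarrow> cond_iii)"
proof -
  interpret identically_distributed_NA M X Y
    using assms(1-5) by (intro identically_distributed_NA.intro identically_distributed_NA_axioms.intro) auto
  have "cond_i \<longleftrightarrow> cond_ii"
    unfolding cond_i_def cond_ii_def
    using sum_excess_moments_eq_integral_tail_series[OF \<open>q > 0\<close>] by (auto simp del: One_nat_def)
  moreover have "cond_ii \<longleftrightarrow> cond_iii"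
  proof
    assume cond_ii
    then show cond_iii
      unfolding cond_ii_def cond_iii_def using tail_integral_imp_moments[OF \<open>r > 1\<close> \<open>q > 0\<close>] by blast
  next
    assume cond_iii
    then show cond_ii
      unfolding cond_ii_def cond_iii_def by (intro moments_imp_tail_integral[OF \<open>r > 1\<close> \<open>q > 0\<close>]) auto
  qed
  ultimately show ?thesis ..
qed

end
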